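(* Let $v_1,v_2,v_3,v_4$ be pairwise distinct positive integers with $\gcd(v_1,v_2,v_3,v_4)=1$ and $v_1+v_2+v_3+v_4\ge196$. Then for every $s_1,s_2,s_3,s_4\in\mathbb{R}$ there is some $t\in\mathbb{R}$ such that $\|v_it+s_i\|\ge\frac15$ for every $1\le i\le4$.
   Context: For $x\in\mathbb{R}$, $\|x\|$ denotes the distance from $x$ to a nearest integer. *)

theory Defs
  imports "HOL-Analysis.Analysis"
begin

definition dist_nearest_int :: "real \<Rightarrow> real" where
  "dist_nearest_int x = \<bar>x - of_int (round x)\<bar>"

text \<open>The value does not depend on how \<^const>\<open>round\<close> breaks ties.\<close>

lemma dist_nearest_int_le: "dist_nearest_int x \<le> \<bar>x - of_int m\<bar>"
  unfolding dist_nearest_int_def by (rule round_diff_minimal)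

lemma dist_nearest_int_eq_infdist: "dist_nearest_int x = infdist x \<int>"
proof (rule antisym)
  show "dist_nearest_int x \<le> infdist x \<int>"
    unfolding infdist_def
    by (auto intro!: cINF_greatest simp: dist_real_def dist_nearest_int_le elim!: Ints_cases)
  have "infdist x \<int> \<le> dist x (of_int (round x))"
    by (rule infdist_le) simp
  then show "infdist x \<int> \<le> dist_nearest_int x"
    by (simp add: dist_nearest_int_def dist_real_def)
qed

end

theory Submission
  imports Defs
begin

text \<open>The runners must reach a translate of the cube of side \<open>3/5\<close> modulo \<open>\<int>\<^sup>4\<close>. Counting the
  crossings of the orbit with a grid of boxes gives an integer vector \<open>w\<close>, not parallel to \<open>v\<close>, and a
  time \<open>t0\<close> with \<open>w - t0 v\<close> small. The orbit then runs close to every point of the plane spanned by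
  \<open>v\<close> and \<open>w\<close>, and it suffices that this plane meets every translate, modulo \<open>\<int>\<^sup>4\<close>, of a slightly
  smaller box. The plane is cut out by two integer vectors \<open>n\<close> and \<open>m\<close>, so the question becomes whether
  the image of the box under \<open>(n, m)\<close> meets every translate of \<open>\<int>\<^sup>2\<close>.

  If every integer vector orthogonal to \<open>v\<close> has \<open>\<ell>\<^sup>1\<close>-norm at least \<open>5\<close>, this holds because the image
  is a symmetric convex set of lattice width at least \<open>2\<close>. Otherwise there is a relation \<open>n\<close> of norm \<open>3\<close> or
  \<open>4\<close>, up to signs and order one of \<open>(1,1,1,0)\<close>, \<open>(2,1,0,0)\<close>, \<open>(3,1,0,0)\<close>, \<open>(1,1,1,1)\<close> and
  \<open>(2,1,1,0)\<close>. The slices of the box orthogonal to \<open>n\<close> are long enough in the direction \<open>m\<close> except for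
  finitely many \<open>m\<close> modulo \<open>n\<close>. These either give a relation treated earlier or determine the plane,
  and then a generator \<open>w\<close> of the lattice in this plane gives a much smaller error.\<close>

subsection \<open>From orbits to planes\<close>

text \<open>Rounding costs half of the error \<open>w - t0 v\<close>. Errors of at most 1/5 leave
  half-sides of at least 1/5, and a cube of half-side 1/5 has width 2/5 times the l1-norm of
  \<open>n\<close> in the direction \<open>n\<close>; norm 5 is where this reaches 2. For norm 4
  such errors are too large: with (1,1,1,1) the corner exceeds the slice at 1/2 by 3/10, so a second
  vector whose entries spread over 3 gives slices of length only 9/10. Six arcs for three of the
  runners raise this to 21/20. For a relation \<open>n\<close> of norm at most 4 the error also
  forces \<open>n\<close> to be normal to the plane: the integer n.w = n.(w - t0 v) is smaller than
  1 in absolute value. When the slices are still too short and no shorter relation appears, both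
  normals are small. The error of a generator of the plane is then a minor of \<open>(n, m)\<close>
  divided by a speed of one's choice, and the lower bound on the total provides a large speed to
  divide by.\<close>

definition dotr :: "(nat \<Rightarrow> int) \<Rightarrow> (nat \<Rightarrow> real) \<Rightarrow> real" where
  "dotr n x = (\<Sum>i\<in>{1..4}. of_int (n i) * x i)"

definition doti :: "(nat \<Rightarrow> int) \<Rightarrow> (nat \<Rightarrow> int) \<Rightarrow> int" where
  "doti n z = (\<Sum>i\<in>{1..4}. n i * z i)"

definition lonely :: "(nat \<Rightarrow> int) \<Rightarrow> bool" where
  "lonely v \<longleftrightarrow> (\<forall>s. \<exists>t. \<forall>i\<in>{1..4}. dist_nearest_int (of_int (v i) * t + s i) \<ge> 1 / 5)"

definition covering :: "(nat \<Rightarrow> int) \<Rightarrow> (nat \<Rightarrow> int) \<Rightarrow> (nat \<Rightarrow> real) \<Rightarrow> bool" where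
  "covering n m h \<longleftrightarrow> (\<forall>c d. \<exists>y (k::int) (l::int). (\<forall>i\<in>{1..4}. \<bar>y i\<bar> \<le> h i) \<and>
     dotr n y = c + of_int k \<and> dotr m y = d + of_int l)"

text \<open>Equivalently, \<open>n\<close> and \<open>m\<close> are a basis of a saturated lattice
  of rank two. It lets a point that solves two equations modulo integers be moved by an integer
  vector to an exact solution.\<close>

definition onto_pair :: "(nat \<Rightarrow> int) \<Rightarrow> (nat \<Rightarrow> int) \<Rightarrow> bool" where
  "onto_pair n m \<longleftrightarrow> (\<forall>k l. \<exists>z. doti n z = k \<and> doti m z = l)"

definition parallel :: "(nat \<Rightarrow> int) \<Rightarrow> (nat \<Rightarrow> int) \<Rightarrow> bool" where
  "parallel v w \<longleftrightarrow> (\<forall>a\<in>{1..4}. \<forall>b\<in>{1..4}. v a * w b = v b * w a)"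

text \<open>A relabelling of the indices, kept as a predicate so that arguments up to permutation
  need no transport of \<open>v\<close>, \<open>w\<close> or the box.\<close>

definition enum4 :: "nat \<Rightarrow> nat \<Rightarrow> nat \<Rightarrow> nat \<Rightarrow> bool" where
  "enum4 a b c d \<longleftrightarrow> {1..4} = {a, b, c, d} \<and> distinct [a, b, c, d]"

lemma atLeastAtMost_1_4: "{1..4} = {1, 2, 3, 4::nat}"
  by auto

lemma enum4_ex:
  assumes "a \<in> {1..4}" "b \<in> {1..4}" "a \<noteq> b"
  shows "\<exists>c d. enum4 a b c d"
proof -
  have "a = 1 \<or> a = 2 \<or> a = 3 \<or> a = 4" "b = 1 \<or> b = 2 \<or> b = 3 \<or> b = 4"
    using assms by auto
  moreover have "enum4 1 2 3 4" "enum4 1 3 2 4" "enum4 1 4 2 3" "enum4 2 1 3 4" "enum4 2 3 1 4" "enum4 2 4 1 3"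
    "enum4 3 1 2 4" "enum4 3 2 1 4" "enum4 3 4 1 2" "enum4 4 1 2 3" "enum4 4 2 1 3" "enum4 4 3 1 2"
    unfolding enum4_def atLeastAtMost_1_4 by auto
  ultimately show ?thesis using assms(3) by blast
qed

lemma enum4_sum:
  assumes "enum4 a b c d"
  shows "sum f {1..4} = f a + f b + f c + (f d :: 'a::comm_monoid_add)"
  using assms unfolding enum4_def by (simp add: add.assoc)

lemma enum4_ball:
  assumes "enum4 a b c d"
  shows "(\<forall>i\<in>{1..4}. P i) \<longleftrightarrow> P a \<and> P b \<and> P c \<and> P d"
  using assms unfolding enum4_def by simp

lemma enum4_mem:
  assumes "enum4 a b c d"
  shows "a \<in> {1..4}" "b \<in> {1..4}" "c \<in> {1..4}" "d \<in> {1..4}"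
  using assms unfolding enum4_def by simp_all

lemma dotr_of_int: "dotr n (\<lambda>i. of_int (z i)) = of_int (doti n z)"
  by (simp add: dotr_def doti_def)

lemma dotr_add: "dotr n (\<lambda>i. x i + y i) = dotr n x + dotr n y"
  by (simp add: dotr_def algebra_simps sum.distrib)

lemma dotr_diff: "dotr n (\<lambda>i. x i - y i) = dotr n x - dotr n y"
  by (simp add: dotr_def algebra_simps sum_subtractf)

lemma dotr_scale: "dotr n (\<lambda>i. a * x i) = a * dotr n x"
  by (simp add: dotr_def sum_distrib_left algebra_simps)

lemma dist_nearest_int_ge:
  assumes "\<bar>x - of_int z - 1/2\<bar> \<le> 3/10"
  shows "dist_nearest_int x \<ge> 1/5"
proof -
  have "\<bar>x - of_int k\<bar> \<ge> 1/5" for k :: int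
  proof (cases "k \<le> z")
    case True
    then have "real_of_int k \<le> of_int z" by simp
    then show ?thesis using assms by linarith
  next
    case False
    then have "real_of_int k \<ge> of_int z + 1" by linarith
    then show ?thesis using assms by linarith
  qed
  then show ?thesis by (simp add: dist_nearest_int_def)
qed

lemma onto_pair_independent:
  assumes "onto_pair n m" "\<And>i. i \<in> {1..4} \<Longrightarrow> \<alpha> * n i + \<beta> * m i = 0"
  shows "\<alpha> = 0 \<and> \<beta> = 0"
proof -
  have lin: "\<alpha> * doti n z + \<beta> * doti m z = 0" for z
  proof -
    have "\<alpha> * doti n z + \<beta> * doti m z = (\<Sum>i\<in>{1..4}. (\<alpha> * n i + \<beta> * m i) * z i)"
      by (simp add: doti_def sum_distrib_left sum.distrib[symmetric] algebra_simps)
    also have "\<dots> = 0" using assms(2) by (intro sum.neutral) simp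
    finally show ?thesis .
  qed
  obtain z1 z2 where "doti n z1 = 1" "doti m z1 = 0" "doti n z2 = 0" "doti m z2 = 1"
    using assms(1) unfolding onto_pair_def by meson
  with lin[of z1] lin[of z2] show ?thesis by simp
qed

text \<open>Complementary minors: Cramer's rule on two coordinates where \<open>(v, w)\<close> has a
  nonzero minor clears \<open>x\<close> there. On the other two coordinates \<open>(n, m)\<close>
  has a nonzero minor, which clears the rest.\<close>

lemma kernel_spanned:
  assumes np: "\<not> parallel v w" and onto: "onto_pair n m"
    and orth: "doti n v = 0" "doti n w = 0" "doti m v = 0" "doti m w = 0"
    and x: "dotr n x = 0" "dotr m x = 0"
  shows "\<exists>t s. \<forall>i\<in>{1..4}. x i = of_int (v i) * t + of_int (w i) * s"
proof -
  obtain a b where ab: "a \<in> {1..4}" "b \<in> {1..4}" "v a * w b \<noteq> v b * w a"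
    using np unfolding parallel_def by blast
  then have "a \<noteq> b" by auto
  then obtain c d where e: "enum4 a b c d" using enum4_ex ab by blast
  define P where "P = v a * w b - v b * w a"
  have P: "P \<noteq> 0" using ab by (simp add: P_def)
  define t where "t = (x a * of_int (w b) - x b * of_int (w a)) / of_int P"
  define s where "s = (of_int (v a) * x b - of_int (v b) * x a) / of_int P"
  define x' where "x' i = x i - (t * of_int (v i) + s * of_int (w i))" for i
  have orth': "dotr n (\<lambda>i. of_int (v i)) = 0" "dotr n (\<lambda>i. of_int (w i)) = 0"
    "dotr m (\<lambda>i. of_int (v i)) = 0" "dotr m (\<lambda>i. of_int (w i)) = 0"
    using orth by (simp_all add: dotr_of_int)
  have x'0: "dotr n x' = 0" "dotr m x' = 0"
    unfolding x'_def by (simp_all add: dotr_diff dotr_add dotr_scale x orth')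
  have P': "real_of_int P \<noteq> 0" using P by simp
  have Pe: "real_of_int P = of_int (v a) * of_int (w b) - of_int (v b) * of_int (w a)" by (simp add: P_def)
  have "of_int P * x' a = 0"
  proof -
    have "of_int P * x' a = of_int P * x a - ((of_int P * t) * of_int (v a) + (of_int P * s) * of_int (w a))"
      by (simp add: x'_def algebra_simps)
    also have "of_int P * t = x a * of_int (w b) - x b * of_int (w a)" using P' by (simp add: t_def)
    also have "of_int P * s = of_int (v a) * x b - of_int (v b) * x a" using P' by (simp add: s_def)
    finally show ?thesis by (simp add: Pe algebra_simps)
  qed
  then have xa: "x' a = 0" using P' by simp
  have "of_int P * x' b = 0"
  proof -
    have "of_int P * x' b = of_int P * x b - ((of_int P * t) * of_int (v b) + (of_int P * s) * of_int (w b))"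
      by (simp add: x'_def algebra_simps)
    also have "of_int P * t = x a * of_int (w b) - x b * of_int (w a)" using P' by (simp add: t_def)
    also have "of_int P * s = of_int (v a) * x b - of_int (v b) * x a" using P' by (simp add: s_def)
    finally show ?thesis by (simp add: Pe algebra_simps)
  qed
  then have xb: "x' b = 0" using P' by simp
  \<comment> \<open>A combination of \<open>n\<close> and \<open>m\<close> that vanishes at
    \<open>c\<close> and \<open>d\<close> is still orthogonal to \<open>v\<close> and
    \<open>w\<close>, so the minor \<open>P\<close> kills its entries at \<open>a\<close> and
    \<open>b\<close> too.\<close>
  have q0: "\<alpha> = 0 \<and> \<beta> = 0"
    if "\<alpha> * n c + \<beta> * m c = 0" "\<alpha> * n d + \<beta> * m d = 0" for \<alpha> \<beta>
  proof -
    define q where "q i = \<alpha> * n i + \<beta> * m i" for i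
    have qd: "doti q z = \<alpha> * doti n z + \<beta> * doti m z" for z
      by (simp add: q_def doti_def sum_distrib_left sum.distrib[symmetric] algebra_simps)
    have "doti q v = 0" "doti q w = 0" using orth qd by simp_all
    then have qq: "q a * v a + q b * v b = 0" "q a * w a + q b * w b = 0"
      using that unfolding doti_def enum4_sum[OF e] by (simp_all add: q_def)
    have "q a * P = w b * (q a * v a + q b * v b) - v b * (q a * w a + q b * w b)"
      by (simp add: P_def algebra_simps)
    then have qa: "q a = 0" using qq P by simp
    have "q b * P = v a * (q a * w a + q b * w b) - w a * (q a * v a + q b * v b)"
      by (simp add: P_def algebra_simps)
    then have qb: "q b = 0" using qq P by simp
    have "\<forall>i\<in>{1..4}. q i = 0" unfolding enum4_ball[OF e] using that qa qb by (simp add: q_def)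
    then have "\<alpha> * n i + \<beta> * m i = 0" if "i \<in> {1..4}" for i
      using that by (metis q_def)
    then show ?thesis by (rule onto_pair_independent[OF onto])
  qed
  define D where "D = n c * m d - n d * m c"
  have D: "D \<noteq> 0"
  proof
    assume "D = 0"
    then have "m c = 0 \<and> n c = 0" using q0[of "m c" "- n c"] by (auto simp: D_def algebra_simps)
    moreover have "m d = 0 \<and> n d = 0" using \<open>D = 0\<close> q0[of "m d" "- n d"] by (auto simp: D_def algebra_simps)
    ultimately show False using q0[of 1 0] by simp
  qed
  have eq: "of_int (n c) * x' c + of_int (n d) * x' d = 0" "of_int (m c) * x' c + of_int (m d) * x' d = 0"
    using x'0 xa xb unfolding dotr_def enum4_sum[OF e] by simp_all
  have "of_int D * x' c = of_int (m d) * (of_int (n c) * x' c + of_int (n d) * x' d)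
      - of_int (n d) * (of_int (m c) * x' c + of_int (m d) * x' d)"
    by (simp add: D_def algebra_simps)
  then have xc: "x' c = 0" using D unfolding eq by simp
  have "of_int D * x' d = of_int (n c) * (of_int (m c) * x' c + of_int (m d) * x' d)
      - of_int (m c) * (of_int (n c) * x' c + of_int (n d) * x' d)"
    by (simp add: D_def algebra_simps)
  then have xd: "x' d = 0" using D unfolding eq by simp
  have "\<forall>i\<in>{1..4}. x' i = 0" unfolding enum4_ball[OF e] using xa xb xc xd by simp
  then have "\<forall>i\<in>{1..4}. x i = of_int (v i) * t + of_int (w i) * s"
    by (simp add: x'_def algebra_simps)
  then show ?thesis by blast
qed

text \<open>Rounding the coefficient \<open>a\<close> of \<open>w\<close> to an integer moves a point of the plane spanned by
  \<open>v\<close> and \<open>w\<close> to the orbit of \<open>v\<close>, at the cost of \<open>\<epsilon> i / 2\<close> in coordinate \<open>i\<close>.\<close>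

lemma lonely_if_covering:
  assumes np: "\<not> parallel v w" and onto: "onto_pair n m"
    and orth: "doti n v = 0" "doti n w = 0" "doti m v = 0" "doti m w = 0"
    and eps: "\<And>i. i \<in> {1..4} \<Longrightarrow> \<bar>of_int (w i) - t0 * of_int (v i)\<bar> \<le> \<epsilon> i"
    and cov: "covering n m (\<lambda>i. 3/10 - \<epsilon> i / 2)"
  shows "lonely v"
  unfolding lonely_def
proof
  fix s :: "nat \<Rightarrow> real"
  obtain y k l where y: "\<forall>i\<in>{1..4}. \<bar>y i\<bar> \<le> 3/10 - \<epsilon> i / 2"
    "dotr n y = dotr n (\<lambda>i. s i - 1/2) + of_int k" "dotr m y = dotr m (\<lambda>i. s i - 1/2) + of_int l"
    using cov unfolding covering_def by blast
  obtain z where z: "doti n z = - k" "doti m z = - l"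
    using onto unfolding onto_pair_def by meson
  define x where "x i = y i - (s i - 1/2) + of_int (z i)" for i
  have "dotr n x = 0" "dotr m x = 0"
    unfolding x_def by (simp_all add: dotr_diff[of _ y] dotr_add y z dotr_of_int)
  then obtain t a where ta: "\<forall>i\<in>{1..4}. x i = of_int (v i) * t + of_int (w i) * a"
    using kernel_spanned[OF np onto orth] by blast
  define r where "r = a - of_int (round a)"
  have r: "\<bar>r\<bar> \<le> 1/2" unfolding r_def using of_int_round_abs_le[of a] by linarith
  have "dist_nearest_int (of_int (v i) * (t + r * t0) + s i) \<ge> 1/5" if i: "i \<in> {1..4}" for i
  proof (rule dist_nearest_int_ge)
    let ?z = "z i - w i * round a"
    have a: "a = r + of_int (round a)" by (simp add: r_def)
    have "x i = of_int (v i) * t + of_int (w i) * (r + of_int (round a))"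
      using ta i a by simp
    then have "of_int (v i) * (t + r * t0) + s i - of_int ?z - 1/2
        = y i - r * (of_int (w i) - t0 * of_int (v i))"
      by (simp add: x_def algebra_simps)
    moreover have "\<bar>r * (of_int (w i) - t0 * of_int (v i))\<bar> \<le> 1/2 * \<epsilon> i"
      unfolding abs_mult using r eps[OF i] by (intro mult_mono) auto
    ultimately show "\<bar>of_int (v i) * (t + r * t0) + s i - of_int ?z - 1/2\<bar> \<le> 3/10"
      using bspec[OF y(1) i] by linarith
  qed
  then show "\<exists>t. \<forall>i\<in>{1..4}. dist_nearest_int (of_int (v i) * t + s i) \<ge> 1/5" by blast
qed

subsection \<open>Simultaneous approximation\<close>

text \<open>Cut the circle of runner \<open>j\<close> into \<open>M j\<close> arcs, shifted slightly so that the runners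
  enter arcs at pairwise distinct times. There are more such times than tuples of arcs, so two of
  these times see the same tuple, and their difference is the approximation \<open>t0\<close>.\<close>

lemma simultaneous_approximation:
  fixes v M u :: "nat \<Rightarrow> int"
  assumes vpos: "\<And>i. i \<in> {1..4} \<Longrightarrow> v i > 0" and Mpos: "\<And>i. i \<in> {1..4} \<Longrightarrow> M i > 0"
    and bez: "doti u v = 1" and big: "(\<Prod>i\<in>{1..4}. M i) < (\<Sum>i\<in>{1..4}. M i * v i)"
  shows "\<exists>w t0. \<not> parallel v w \<and> (\<forall>i\<in>{1..4}. \<bar>of_int (w i) - t0 * of_int (v i)\<bar> < 1 / real_of_int (M i))"
proof -
  define a where "a i = M i * v i" for i
  define L where "L = (\<Sum>i\<in>{1..4}. a i)"
  have apos: "a i \<ge> 1" if "i \<in> {1..4}" for i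
    using vpos[OF that] Mpos[OF that] by (simp add: a_def int_one_le_iff_zero_less)
  have aL: "a i \<le> L" if "i \<in> {1..4}" for i
    unfolding L_def using that apos by (intro member_le_sum) (auto intro: order_trans[OF zero_le_one])
  have L1: "L \<ge> 1" using apos[of 1] aL[of 1] by simp
  \<comment> \<open>Distinct fractions with denominators \<open>a i\<close> and \<open>a i'\<close>
    differ by at least \<open>1 / L^2\<close>, more than the largest relative shift
    \<open>3 * \<delta>\<close>; equal fractions of different runners are separated by the shift
    itself.\<close>
  define \<delta> where "\<delta> = 1 / (4 * real_of_int L ^ 2)"
  have \<delta>pos: "\<delta> > 0" using L1 by (simp add: \<delta>_def)
  define E where "E = (SIGMA i:{1..4}. {0..<a i})"
  define T where "T e = real_of_int (snd e) / of_int (a (fst e)) - real (fst e) * \<delta>" for e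
  define g where "g j t = real_of_int (a j) * (t + real j * \<delta>)" for j t
  define code where "code e = restrict (\<lambda>j. \<lfloor>g j (T e)\<rfloor> mod M j) {1..4}" for e
  have idx: "\<bar>real i - real j\<bar> \<le> 3" if "i \<in> {1..4}" "j \<in> {1..4}" for i j :: nat
    using that by auto
  have T_inj: "e = e'" if ee: "e \<in> E" "e' \<in> E" "T e = T e'" for e e'
  proof -
    obtain i k i' k' where e: "e = (i, k)" "e' = (i', k')" by (cases e, cases e')
    have i: "i \<in> {1..4}" "i' \<in> {1..4}" using ee e by (auto simp: E_def)
    have a: "real_of_int (a i) \<ge> 1" "real_of_int (a i') \<ge> 1" using apos i by simp_all
    have "real_of_int k / a i - real_of_int k' / a i' = (real i - real i') * \<delta>"
      using ee(3) by (simp add: T_def e algebra_simps)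
    then have eq: "real_of_int (k * a i' - k' * a i) = (real i - real i') * \<delta> * (a i * a i')"
      using a by (simp add: field_simps)
    have "real_of_int (a i) * real_of_int (a i') \<le> of_int L * of_int L"
      using aL[OF i(1)] aL[OF i(2)] a by (intro mult_mono) auto
    then have "\<delta> * (real_of_int (a i) * real_of_int (a i')) \<le> \<delta> * (of_int L * of_int L)"
      using \<delta>pos by simp
    also have "\<dots> = 1/4" using L1 by (simp add: \<delta>_def power2_eq_square)
    finally have "\<bar>real i - real i'\<bar> * (\<delta> * (real_of_int (a i) * real_of_int (a i'))) \<le> 3 * (1/4)"
      using idx[OF i] \<delta>pos a by (intro mult_mono) auto
    then have "\<bar>real_of_int (k * a i' - k' * a i)\<bar> < 1"
      unfolding eq using \<delta>pos a by (simp add: abs_mult mult.assoc)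
    then have z: "k * a i' - k' * a i = 0" by linarith
    then have "(real i - real i') * \<delta> * (a i * a i') = 0" using eq by simp
    then have "i = i'" using \<delta>pos a by auto
    then show ?thesis using z a by (simp add: e)
  qed
  have cardE: "int (card E) = L"
  proof -
    have "int (card E) = (\<Sum>i\<in>{1..4}. int (card {0..<a i}))"
      unfolding E_def by (subst card_SigmaI) auto
    also have "\<dots> = L" unfolding L_def using apos by (intro sum.cong) (auto, force)
    finally show ?thesis .
  qed
  have finE: "finite E" unfolding E_def by auto
  have code_in: "code ` E \<subseteq> (\<Pi>\<^sub>E j\<in>{1..4}. {0..<M j})"
    using Mpos by (auto simp: code_def)
  have fin: "finite (\<Pi>\<^sub>E j\<in>{1..4::nat}. {0..<M j})" by (intro finite_PiE) auto
  have "int (card (\<Pi>\<^sub>E j\<in>{1..4::nat}. {0..<M j})) = (\<Prod>i\<in>{1..4}. M i)"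
    unfolding card_PiE[OF finite_atLeastAtMost] of_nat_prod using Mpos
    by (intro prod.cong) (auto, force)
  then have "int (card (code ` E)) < int (card E)"
    using card_mono[OF fin code_in] big unfolding cardE L_def a_def by linarith
  then have "\<not> inj_on code E" by (intro pigeonhole) simp
  then obtain e0 e1 where e01: "e0 \<in> E" "e1 \<in> E" "e0 \<noteq> e1" "code e0 = code e1"
    unfolding inj_on_def by blast
  then have "T e0 \<noteq> T e1" using T_inj by blast
  then obtain e e' where e: "e \<in> E" "e' \<in> E" "T e < T e'" "code e = code e'"
    using e01 by (metis linorder_neqE)
  obtain i k i' k' where ik: "e = (i, k)" "e' = (i', k')" by (cases e, cases e')
  have i: "i \<in> {1..4}" "i' \<in> {1..4}" and k: "k \<ge> 0" "k < a i" "k' \<ge> 0" "k' < a i'"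
    using e ik by (auto simp: E_def)
  define w where "w j = (\<lfloor>g j (T e')\<rfloor> - \<lfloor>g j (T e)\<rfloor>) div M j" for j
  have w: "w j * M j = \<lfloor>g j (T e')\<rfloor> - \<lfloor>g j (T e)\<rfloor>" if j: "j \<in> {1..4}" for j
  proof -
    have "\<lfloor>g j (T e')\<rfloor> mod M j = \<lfloor>g j (T e)\<rfloor> mod M j"
      using fun_cong[OF e(4), of j] j by (simp add: code_def)
    then have "M j dvd \<lfloor>g j (T e')\<rfloor> - \<lfloor>g j (T e)\<rfloor>" by (simp add: mod_eq_dvd_iff)
    then show ?thesis by (simp add: w_def)
  qed
  define t0 where "t0 = T e' - T e"
  have close: "\<bar>of_int (w j) - t0 * of_int (v j)\<bar> < 1 / real_of_int (M j)" if j: "j \<in> {1..4}" for j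
  proof -
    have M: "real_of_int (M j) > 0" using Mpos[OF j] by simp
    have "real_of_int (w j * M j) = of_int \<lfloor>g j (T e')\<rfloor> - of_int \<lfloor>g j (T e)\<rfloor>"
      unfolding w[OF j] by simp
    moreover have "g j (T e') - g j (T e) = of_int (M j) * (t0 * of_int (v j))"
      by (simp add: g_def a_def t0_def algebra_simps)
    ultimately have "\<bar>real_of_int (w j * M j) - of_int (M j) * (t0 * of_int (v j))\<bar> < 1"
      by linarith
    then have "\<bar>of_int (M j) * (of_int (w j) - t0 * of_int (v j))\<bar> < 1"
      by (simp add: algebra_simps)
    then have "of_int (M j) * \<bar>of_int (w j) - t0 * of_int (v j)\<bar> < 1"
      using M by (simp only: abs_mult abs_of_pos)
    then show ?thesis using M by (simp only: pos_less_divide_eq mult.commute)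
  qed
  \<comment> \<open>The later time is an entry of runner \<open>i'\<close> into an arc, so its floor
    is strictly larger there than at the earlier time.\<close>
  have wi': "w i' > 0"
  proof -
    have "g i' (T e') = of_int k'"
      using apos[OF i(2)] by (simp add: g_def T_def ik)
    moreover have "g i' (T e) < g i' (T e')"
      using e(3) apos[OF i(2)] by (simp add: g_def)
    ultimately have "\<lfloor>g i' (T e)\<rfloor> < \<lfloor>g i' (T e')\<rfloor>"
      by (simp add: floor_less_iff)
    then have "w i' * M i' > 0" using w[OF i(2)] by simp
    then show ?thesis using Mpos[OF i(2)] by (simp add: zero_less_mult_iff)
  qed
  have t01: "t0 < 1"
  proof -
    have a: "real_of_int (a i') \<ge> 1" "real_of_int (a i') \<le> of_int L" "real_of_int (a i) \<ge> 1"
      using apos i aL by simp_all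
    have "real_of_int k' \<le> of_int (a i') - 1" using k by linarith
    then have "real_of_int k' / of_int (a i') \<le> (of_int (a i') - 1) / of_int (a i')"
      using a by (intro divide_right_mono) auto
    also have "\<dots> = 1 - 1 / of_int (a i')" using a by (simp add: field_simps)
    also have "\<dots> \<le> 1 - 1 / of_int L" using a L1 by (simp add: field_simps)
    finally have "real_of_int k' / of_int (a i') \<le> 1 - 1 / of_int L" .
    moreover have "real_of_int k / of_int (a i) \<ge> 0" using k a by simp
    moreover have "(real i - real i') * \<delta> \<le> 3 * \<delta>" using idx[OF i] \<delta>pos by (intro mult_right_mono) auto
    moreover have "3 * \<delta> < 1 / of_int L"
    proof -
      have "3 < 4 * real_of_int L" using L1 by simp
      then show ?thesis using L1 by (simp add: \<delta>_def power2_eq_square field_simps)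
    qed
    moreover have "t0 = real_of_int k' / of_int (a i') - real_of_int k / of_int (a i) + (real i - real i') * \<delta>"
      by (simp add: t0_def T_def ik algebra_simps)
    ultimately show ?thesis by linarith
  qed
  \<comment> \<open>At the earlier time runner \<open>i\<close> is exactly at the start of an arc,
    so within less than one unit of time it cannot enter \<open>a i\<close> further arcs.\<close>
  have wi: "w i < v i"
  proof -
    have gk: "g i (T e) = of_int k"
      using apos[OF i(1)] by (simp add: g_def T_def ik)
    have "g i (T e') = g i (T e) + of_int (a i) * t0" by (simp add: g_def t0_def algebra_simps)
    also have "\<dots> < of_int k + of_int (a i) * 1"
      unfolding gk using apos[OF i(1)] t01 by (intro add_strict_left_mono mult_strict_left_mono) auto
    finally have "\<lfloor>g i (T e')\<rfloor> < k + a i" by (simp add: floor_less_iff)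
    then have "w i * M i < v i * M i" using w[OF i(1)] gk by (simp add: a_def mult.commute)
    then show ?thesis using Mpos[OF i(1)] by simp
  qed
  \<comment> \<open>By the Bezout vector a parallel \<open>w\<close> would be an integer multiple
    \<open>q\<close> of \<open>v\<close>; the last two facts give \<open>q > 0\<close> and
    \<open>q < 1\<close>.\<close>
  have "\<not> parallel v w"
  proof
    assume par: "parallel v w"
    define q where "q = doti u w"
    have wq: "w j = v j * q" if j: "j \<in> {1..4}" for j
    proof -
      have "w j = (\<Sum>b\<in>{1..4}. u b * v b) * w j" using bez by (simp add: doti_def)
      also have "\<dots> = (\<Sum>b\<in>{1..4}. u b * (v b * w j))" by (simp add: sum_distrib_right mult.assoc)
      also have "\<dots> = (\<Sum>b\<in>{1..4}. u b * (v j * w b))"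
        using par j unfolding parallel_def by (intro sum.cong) auto
      also have "\<dots> = v j * q" by (simp add: q_def doti_def sum_distrib_left algebra_simps)
      finally show ?thesis .
    qed
    have "q > 0" using wq[OF i(2)] wi' vpos[OF i(2)] by (simp add: zero_less_mult_iff)
    moreover have "q < 1" using wq[OF i(1)] wi vpos[OF i(1)] by simp
    ultimately show False by simp
  qed
  with close show ?thesis by blast
qed

subsection \<open>Lattice planes\<close>

lemma doti_lincomb:
  "doti (\<lambda>i. a * n i + b * m i) z = a * doti n z + b * doti m z"
  "doti n (\<lambda>i. a * y i + b * z i) = a * doti n y + b * doti n z"
  by (simp_all add: doti_def sum_distrib_left sum.distrib algebra_simps)

text \<open>The orthogonal complement of \<open>v\<close> and \<open>w\<close> has rank two. If
  every relation vanished on the kernel of \<open>n\<close>, all of them would be multiples of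
  \<open>n\<close>.\<close>

lemma orthogonal_independent:
  assumes np: "\<not> parallel v w" 
    and nv: "doti n v = 0" "doti n w = 0" and nz: "doti n z0 = 1"
  shows "\<exists>m'. doti m' v = 0 \<and> doti m' w = 0 \<and> (\<exists>z. doti n z = 0 \<and> doti m' z \<noteq> 0)"
proof (rule ccontr)
  assume H: "\<not> ?thesis"
  obtain a b where ab: "a \<in> {1..4}" "b \<in> {1..4}" "v a * w b \<noteq> v b * w a"
    using np unfolding parallel_def by blast
  then have "a \<noteq> b" by auto
  then obtain c d where e: "enum4 a b c d" using enum4_ex ab by blast
  define P where "P i j = v i * w j - v j * w i" for i j
  have P: "P a b \<noteq> 0" using ab by (simp add: P_def)
  have dist: "a \<noteq> b" "a \<noteq> c" "a \<noteq> d" "b \<noteq> c" "b \<noteq> d" "c \<noteq> d"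
    using e by (auto simp: enum4_def)
  have scal: "m' i = doti m' z0 * n i" if m': "doti m' v = 0" "doti m' w = 0" and i: "i \<in> {1..4}" for m' i
  proof -
    \<comment> \<open>The unit vector at \<open>i\<close>, projected along \<open>z0\<close> into
      the kernel of \<open>n\<close>. The same projection gives integrality in
      \<open>onto_pair_completion\<close>.\<close>
    define z where "z = (\<lambda>j. 1 * (if j = i then 1 else 0) + (- n i) * z0 j)"
    have del: "doti y (\<lambda>j. if j = i then 1 else 0) = y i" for y
      using i by (simp add: doti_def if_distrib cong: if_cong)
    have "doti n z = 0" unfolding z_def doti_lincomb del nz by simp
    then have "doti m' z = 0" using H m' by blast
    then show ?thesis unfolding z_def doti_lincomb del by simp
  qed
  \<comment> \<open>Cross products of \<open>v\<close> and \<open>w\<close> on the coordinates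
    \<open>a, b, c\<close> and \<open>a, b, d\<close>. Their entries at \<open>c\<close> and
    \<open>d\<close> show that they are not multiples of one vector.\<close>
  define u1 where "u1 = (\<lambda>i. if i = a then P b c else if i = b then - P a c else if i = c then P a b else 0)"
  define u2 where "u2 = (\<lambda>i. if i = a then P b d else if i = b then - P a d else if i = d then P a b else 0)"
  have u1: "doti u1 v = 0" "doti u1 w = 0" and u2: "doti u2 v = 0" "doti u2 w = 0"
    unfolding doti_def enum4_sum[OF e] u1_def u2_def P_def using dist by (auto simp: algebra_simps)
  have "u1 c = P a b" "u1 d = 0" "u2 c = 0" "u2 d = P a b" using dist by (auto simp: u1_def u2_def)
  then show False using scal[OF u1, of c] scal[OF u1, of d] scal[OF u2, of c] scal[OF u2, of d] P
    enum4_mem[OF e] by (metis mult_eq_0_iff)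
qed

lemma int_subgroup_principal:
  fixes S :: "int set"
  assumes "x0 \<in> S" "x0 \<noteq> 0" and sub: "\<And>x y q. x \<in> S \<Longrightarrow> y \<in> S \<Longrightarrow> x - q * y \<in> S"
  shows "\<exists>d\<in>S. d > 0 \<and> (\<forall>x\<in>S. d dvd x)"
proof -
  have "\<exists>n. 0 < n \<and> int n \<in> S"
  proof (cases "x0 > 0")
    case True
    then show ?thesis using assms by (intro exI[of _ "nat x0"]) auto
  next
    case False
    have "- x0 \<in> S" using sub[OF assms(1) assms(1), of 2] by simp
    with False show ?thesis using assms by (intro exI[of _ "nat (- x0)"]) auto
  qed
  note ex = this
  define n where "n = (LEAST k. 0 < k \<and> int k \<in> S)"
  have n: "0 < n \<and> int n \<in> S" unfolding n_def using ex by (rule LeastI_ex)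
  have min: "n \<le> k" if "0 < k \<and> int k \<in> S" for k
    unfolding n_def using that by (rule Least_le)
  have "int n dvd x" if "x \<in> S" for x
  proof (rule ccontr)
    assume nd: "\<not> int n dvd x"
    have pos: "x mod int n \<ge> 0" using n by simp
    have "x - (x div int n) * int n \<in> S" using sub that n by blast
    then have "int (nat (x mod int n)) \<in> S" using n by (simp add: minus_div_mult_eq_mod)
    moreover have "nat (x mod int n) > 0" 
    proof -
      have "x mod int n \<noteq> 0" using nd by (simp add: dvd_eq_mod_eq_0)
      then show ?thesis using pos by linarith
    qed
    ultimately have "n \<le> nat (x mod int n)" using min by blast
    moreover have "x mod int n < int n" using n by simp
    ultimately show False using pos by linarith
  qed
  then show ?thesis using n by (intro bexI[of _ "int n"]) auto
qed

text \<open>The values of an independent relation \<open>m'\<close> on the kernel of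
  \<open>n\<close> form a group generated by some \<open>d\<close>. Subtracting the multiple of
  \<open>n\<close> that makes \<open>m'\<close> vanish at \<open>z0\<close> leaves a vector
  divisible by \<open>d\<close>, and the quotient completes \<open>n\<close>.\<close>

lemma onto_pair_completion:
  assumes np: "\<not> parallel v w"
    and n: "doti n v = 0" "doti n w = 0" and nz: "doti n z0 = 1"
  shows "\<exists>m. doti m v = 0 \<and> doti m w = 0 \<and> onto_pair n m"
proof -
  obtain m' z1 where m': "doti m' v = 0" "doti m' w = 0" "doti n z1 = 0" "doti m' z1 \<noteq> 0"
    using orthogonal_independent[OF np n nz] by blast
  define S where "S = {doti m' z | z. doti n z = 0}"
  have "\<exists>d\<in>S. d > 0 \<and> (\<forall>x\<in>S. d dvd x)"
  proof (rule int_subgroup_principal)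
    show "doti m' z1 \<in> S" using m' by (auto simp: S_def)
    show "doti m' z1 \<noteq> 0" by fact
    fix x y q assume "x \<in> S" "y \<in> S"
    then obtain zx zy where "x = doti m' zx" "doti n zx = 0" "y = doti m' zy" "doti n zy = 0"
      by (auto simp: S_def)
    then show "x - q * y \<in> S" unfolding S_def
      by (intro CollectI exI[of _ "\<lambda>i. 1 * zx i + (- q) * zy i"]) (simp only: doti_lincomb, simp)
  qed
  then obtain d zd where d: "d > 0" "doti n zd = 0" "doti m' zd = d"
    and dvd: "\<And>z. doti n z = 0 \<Longrightarrow> d dvd doti m' z"
    by (auto simp: S_def)
  define k where "k = doti m' z0"
  define m where "m i = (m' i - k * n i) div d" for i
  have m: "d * m i = m' i - k * n i" if i: "i \<in> {1..4}" for i
  proof -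
    define z where "z = (\<lambda>j. 1 * (if j = i then 1 else 0) + (- n i) * z0 j)"
    have del: "doti y (\<lambda>j. if j = i then 1 else 0) = y i" for y
      using i by (simp add: doti_def if_distrib cong: if_cong)
    have "doti n z = 0" unfolding z_def doti_lincomb del nz by simp
    then have "d dvd doti m' z" by (rule dvd)
    moreover have "doti m' z = m' i - k * n i" unfolding z_def doti_lincomb del by (simp add: k_def)
    ultimately show ?thesis by (simp add: m_def)
  qed
  have dm: "d * doti m z = doti m' z - k * doti n z" for z
  proof -
    have "d * doti m z = (\<Sum>i\<in>{1..4}. (d * m i) * z i)" by (simp add: doti_def sum_distrib_left mult.assoc)
    also have "\<dots> = (\<Sum>i\<in>{1..4}. (m' i - k * n i) * z i)" using m by (intro sum.cong) auto
    also have "\<dots> = doti m' z - k * doti n z"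
      by (simp add: doti_def sum_distrib_left sum_subtractf algebra_simps)
    finally show ?thesis .
  qed
  have "doti m v = 0" "doti m w = 0" using dm[of v] dm[of w] d n m' by simp_all
  moreover have "doti m zd = 1" using dm[of zd] d by simp
  moreover have "doti m z0 = 0" using dm[of z0] d nz by (simp add: k_def)
  moreover have "onto_pair n m" if "doti m zd = 1" "doti m z0 = 0"
    unfolding onto_pair_def
  proof (intro allI)
    fix k l
    show "\<exists>z. doti n z = k \<and> doti m z = l"
      by (rule exI[of _ "\<lambda>i. k * z0 i + l * zd i"]) (simp only: doti_lincomb that d nz, simp)
  qed
  ultimately show ?thesis by blast
qed

text \<open>The vector \<open>w\<close> below is the four-dimensional cross product of \<open>n\<close>, \<open>m\<close> and a Bezout
  vector of \<open>v\<close>. Choosing it makes the \<open>2 \<times> 2\<close> minors of \<open>(v, w)\<close> equal, up to sign, to the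
  complementary minors of \<open>(n, m)\<close>.\<close>

lemma dual_minors:
  assumes e: "enum4 i j k l" and bez: "doti u v = 1" and orth: "doti n v = 0" "doti m v = 0"
  shows "\<exists>w. doti n w = 0 \<and> doti m w = 0 \<and>
    \<bar>v i * w j - v j * w i\<bar> = \<bar>n k * m l - n l * m k\<bar> \<and>
    \<bar>v i * w k - v k * w i\<bar> = \<bar>n j * m l - n l * m j\<bar> \<and>
    \<bar>v i * w l - v l * w i\<bar> = \<bar>n j * m k - n k * m j\<bar> \<and>
    \<bar>v j * w k - v k * w j\<bar> = \<bar>n i * m l - n l * m i\<bar> \<and>
    \<bar>v j * w l - v l * w j\<bar> = \<bar>n i * m k - n k * m i\<bar> \<and>
    \<bar>v k * w l - v l * w k\<bar> = \<bar>n i * m j - n j * m i\<bar>"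
proof -
  \<comment> \<open>The determinant of the columns \<open>x, y, z\<close> of the matrix with rows
    \<open>u\<close>, \<open>n\<close>, \<open>m\<close>.\<close>
  define D where "D x y z = u x * (n y * m z - n z * m y) - u y * (n x * m z - n z * m x)
    + u z * (n x * m y - n y * m x)" for x y z
  \<comment> \<open>Contracting with \<open>v\<close> pairs each row with \<open>v\<close>:
    \<open>u\<close> gives 1 and keeps the minor of \<open>(n, m)\<close>, while \<open>n\<close>
    and \<open>m\<close> give 0.\<close>
  have minor: "v a * D a c d + v b * D b c d = n c * m d - n d * m c" if e': "enum4 a b c d" for a b c d
  proof -
    have "v a * D a c d + v b * D b c d = (n c * m d - n d * m c) * doti u v
      - (u c * m d - u d * m c) * doti n v + (u c * n d - u d * n c) * doti m v"
      unfolding doti_def enum4_sum[OF e'] D_def by (simp add: algebra_simps)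
    then show ?thesis using bez orth by simp
  qed
  have alt: "D x y z = - D y x z" for x y z by (simp add: D_def algebra_simps)
  have alt': "D x y z = - D x z y" for x y z by (simp add: D_def algebra_simps)
  have E: "enum4 i j k l" "enum4 i k j l" "enum4 i l j k" "enum4 j k i l" "enum4 j l i k" "enum4 k l i j"
    using e unfolding enum4_def by auto
  define w where "w x = (if x = i then D j k l else if x = j then - D i k l else if x = k then D i j l else - D i j k)" for x
  have w: "w i = D j k l" "w j = - D i k l" "w k = D i j l" "w l = - D i j k"
    using e by (auto simp: w_def enum4_def)
  have "doti n w = 0" "doti m w = 0"
    unfolding doti_def enum4_sum[OF e] w D_def by (simp_all add: algebra_simps)
  moreover have "v i * w j - v j * w i = - (n k * m l - n l * m k)"
    using minor[OF E(1)] by (simp add: w)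
  moreover have "v i * w k - v k * w i = n j * m l - n l * m j"
    using minor[OF E(2)] alt[of k j l] by (simp add: w)
  moreover have "v i * w l - v l * w i = - (n j * m k - n k * m j)"
    using minor[OF E(3)] alt[of l j k] alt'[of j l k] by (simp add: w)
  moreover have "v j * w k - v k * w j = - (n i * m l - n l * m i)"
    using minor[OF E(4)] alt[of j i l] alt[of k i l] by (simp add: w)
  moreover have "v j * w l - v l * w j = n i * m k - n k * m i"
    using minor[OF E(5)] alt[of j i k] alt[of l i k] alt'[of i l k] by (simp add: w)
  moreover have "v k * w l - v l * w k = - (n i * m j - n j * m i)"
    using minor[OF E(6)] alt'[of i k j] alt[of k i j] alt[of l i j] alt'[of i l j] by (simp add: w)
  ultimately show ?thesis by (intro exI[of _ w]) (simp add: abs_minus_commute)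
qed

text \<open>With \<open>t0 = w i / v i\<close> runner \<open>i\<close> is not perturbed, and the
  error of runner \<open>a\<close> is the minor of \<open>(v, w)\<close> at \<open>i, a\<close> over
  \<open>v i\<close>, hence up to sign the complementary minor of \<open>(n, m)\<close> over
  \<open>v i\<close>. The choice of \<open>i\<close> decides which speed is divided by.\<close>

lemma lonely_if_covering_minors:
  assumes e: "enum4 i j k l" and bez: "doti u v = 1" and orth: "doti n v = 0" "doti m v = 0"
    and onto: "onto_pair n m" and vi: "v i \<noteq> 0"
    and eps: "0 \<le> \<epsilon> i" "\<bar>real_of_int (n k * m l - n l * m k)\<bar> \<le> \<epsilon> j * \<bar>of_int (v i)\<bar>"
      "\<bar>real_of_int (n j * m l - n l * m j)\<bar> \<le> \<epsilon> k * \<bar>of_int (v i)\<bar>"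
      "\<bar>real_of_int (n j * m k - n k * m j)\<bar> \<le> \<epsilon> l * \<bar>of_int (v i)\<bar>"
    and cov: "covering n m (\<lambda>x. 3/10 - \<epsilon> x / 2)"
  shows "lonely v"
proof -
  obtain w where w: "doti n w = 0" "doti m w = 0"
    "\<bar>v i * w j - v j * w i\<bar> = \<bar>n k * m l - n l * m k\<bar>"
    "\<bar>v i * w k - v k * w i\<bar> = \<bar>n j * m l - n l * m j\<bar>"
    "\<bar>v i * w l - v l * w i\<bar> = \<bar>n j * m k - n k * m j\<bar>"
    "\<bar>v j * w k - v k * w j\<bar> = \<bar>n i * m l - n l * m i\<bar>"
    "\<bar>v j * w l - v l * w j\<bar> = \<bar>n i * m k - n k * m i\<bar>"
    "\<bar>v k * w l - v l * w k\<bar> = \<bar>n i * m j - n j * m i\<bar>"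
    using dual_minors[OF e bez orth] by blast
  have np: "\<not> parallel v w"
  proof
    assume "parallel v w"
    then have "\<bar>n k * m l - n l * m k\<bar> = 0" "\<bar>n j * m l - n l * m j\<bar> = 0" "\<bar>n j * m k - n k * m j\<bar> = 0"
      "\<bar>n i * m l - n l * m i\<bar> = 0" "\<bar>n i * m k - n k * m i\<bar> = 0" "\<bar>n i * m j - n j * m i\<bar> = 0"
      unfolding w(3-8)[symmetric] using enum4_mem[OF e] unfolding parallel_def by simp_all
    then have "\<forall>a\<in>{1..4}. \<forall>b\<in>{1..4}. m a * n b + - n a * m b = 0"
      unfolding enum4_ball[OF e] by (simp add: algebra_simps)
    then have "m a = 0 \<and> n a = 0" if "a \<in> {1..4}" for a
      using onto_pair_independent[OF onto, of "m a" "- n a"] that by auto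
    then have "(1::int) = 0 \<and> (1::int) = 0"
      by (intro onto_pair_independent[OF onto]) simp
    then show False by simp
  qed
  define t0 where "t0 = real_of_int (w i) / of_int (v i)"
  have vi': "\<bar>real_of_int (v i)\<bar> > 0" using vi by simp
  have dev: "\<bar>of_int (w a) - t0 * of_int (v a)\<bar> \<le> \<epsilon> a"
    if "\<bar>real_of_int (v i * w a - v a * w i)\<bar> \<le> \<epsilon> a * \<bar>of_int (v i)\<bar>" for a
  proof -
    have "of_int (w a) - t0 * of_int (v a) = real_of_int (v i * w a - v a * w i) / of_int (v i)"
      using vi by (simp add: t0_def field_simps)
    then show ?thesis using that vi' by (simp add: abs_divide pos_divide_le_eq)
  qed
  have ab: "\<bar>real_of_int x\<bar> = \<bar>real_of_int y\<bar>" if "\<bar>x\<bar> = \<bar>y\<bar>" for x y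
    using that by (metis of_int_abs)
  have "\<forall>a\<in>{1..4}. \<bar>of_int (w a) - t0 * of_int (v a)\<bar> \<le> \<epsilon> a"
    unfolding enum4_ball[OF e]
  proof (intro conjI dev)
    show "\<bar>real_of_int (v i * w i - v i * w i)\<bar> \<le> \<epsilon> i * \<bar>of_int (v i)\<bar>" using eps(1) by simp
    show "\<bar>real_of_int (v i * w j - v j * w i)\<bar> \<le> \<epsilon> j * \<bar>of_int (v i)\<bar>" unfolding ab[OF w(3)] by fact
    show "\<bar>real_of_int (v i * w k - v k * w i)\<bar> \<le> \<epsilon> k * \<bar>of_int (v i)\<bar>" unfolding ab[OF w(4)] by fact
    show "\<bar>real_of_int (v i * w l - v l * w i)\<bar> \<le> \<epsilon> l * \<bar>of_int (v i)\<bar>" unfolding ab[OF w(5)] by fact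
  qed
  then show ?thesis
    using lonely_if_covering[OF np onto orth(1) w(1) orth(2) w(2) _ cov, of t0] by blast
qed

subsection \<open>Slices of the box\<close>

text \<open>The slices \<open>n \<bullet> y = c\<close> of the box are shortest, in the direction \<open>m\<close>, for \<open>\<bar>c\<bar> = 1/2\<close>.\<close>

lemma covering_if_slice:
  assumes bp: "\<And>i. i \<in> {1..4} \<Longrightarrow> \<bar>yp i\<bar> \<le> h i" "\<And>i. i \<in> {1..4} \<Longrightarrow> \<bar>ym i\<bar> \<le> h i"
    and n: "dotr n yp = 1/2" "dotr n ym = 1/2" and m: "dotr m yp - dotr m ym \<ge> 1"
  shows "covering n m h"
  unfolding covering_def
proof (intro allI)
  fix c d :: real
  define k where "k = - round c"
  define \<tau> where "\<tau> = 2 * (c + of_int k)"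
  have "of_int (round c) - c \<le> 1/2" "- (of_int (round c) - c) \<le> 1/2"
    using of_int_round_abs_le[of c] by (simp_all only: abs_le_iff)
  moreover have "\<tau> = 2 * (c - of_int (round c))" by (simp add: \<tau>_def k_def)
  ultimately have \<tau>: "-1 \<le> \<tau>" "\<tau> \<le> 1" by (simp_all add: field_simps)
  \<comment> \<open>By symmetry \<open>- ym\<close> and \<open>- yp\<close> lie in the slice at
    \<open>-1/2\<close>. Averaging them with \<open>yp\<close> and \<open>ym\<close> reaches every
    slice between, and the extent in direction \<open>m\<close> stays the same.\<close>
  define top where "top i = (1 + \<tau>)/2 * yp i - (1 - \<tau>)/2 * ym i" for i
  define bot where "bot i = (1 + \<tau>)/2 * ym i - (1 - \<tau>)/2 * yp i" for i
  have dt: "dotr x top = (1 + \<tau>)/2 * dotr x yp - (1 - \<tau>)/2 * dotr x ym"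
    "dotr x bot = (1 + \<tau>)/2 * dotr x ym - (1 - \<tau>)/2 * dotr x yp" for x
    unfolding top_def bot_def by (simp_all only: dotr_diff dotr_scale)
  have ntop: "dotr n top = \<tau>/2" "dotr n bot = \<tau>/2" unfolding dt n by (simp_all add: field_simps)
  have mid: "dotr m top - dotr m bot = dotr m yp - dotr m ym" unfolding dt by (simp add: field_simps)
  define l where "l = \<lceil>dotr m bot - d\<rceil>"
  have l: "dotr m bot \<le> d + of_int l" "d + of_int l \<le> dotr m top"
    using m mid unfolding l_def by linarith+
  define \<mu> where "\<mu> = (d + of_int l - dotr m bot) / (dotr m top - dotr m bot)"
  have pos: "dotr m top - dotr m bot > 0" using m mid by linarith
  have \<mu>: "0 \<le> \<mu>" "\<mu> \<le> 1" using l pos by (auto simp: \<mu>_def)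
  define y where "y i = \<mu> * top i + (1 - \<mu>) * bot i" for i
  have dy: "dotr x y = \<mu> * dotr x top + (1 - \<mu>) * dotr x bot" for x
    unfolding y_def by (simp only: dotr_add dotr_scale)
  have conv: "\<bar>a * p + (1 - a) * q\<bar> \<le> H" if "0 \<le> a" "a \<le> 1" "\<bar>p\<bar> \<le> H" "\<bar>q\<bar> \<le> H" for a p q H :: real
  proof -
    have "\<bar>a * p + (1 - a) * q\<bar> \<le> a * \<bar>p\<bar> + (1 - a) * \<bar>q\<bar>"
      using that by (intro order_trans[OF abs_triangle_ineq]) (simp add: abs_mult)
    also have "\<dots> \<le> H" using convex_bound_le[of "\<bar>p\<bar>" H "\<bar>q\<bar>" a "1 - a"] that by simp
    finally show ?thesis .
  qed
  have "\<bar>y i\<bar> \<le> h i" if i: "i \<in> {1..4}" for i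
  proof -
    have "\<bar>top i\<bar> \<le> h i" "\<bar>bot i\<bar> \<le> h i"
      using conv[of "(1 + \<tau>)/2" "yp i" "h i" "- ym i"] conv[of "(1 + \<tau>)/2" "ym i" "h i" "- yp i"] bp[OF i] \<tau>
      by (simp_all add: top_def bot_def field_simps)
    then show ?thesis unfolding y_def using \<mu> by (intro conv) auto
  qed
  moreover have "dotr n y = c + of_int k" unfolding dy ntop by (simp add: \<tau>_def field_simps)
  moreover have "dotr m y = d + of_int l"
  proof -
    have "dotr m y = dotr m bot + \<mu> * (dotr m top - dotr m bot)" unfolding dy by (simp add: algebra_simps)
    then show ?thesis using pos by (simp add: \<mu>_def)
  qed
  ultimately show "\<exists>y k l. (\<forall>i\<in>{1..4}. \<bar>y i\<bar> \<le> h i) \<and> dotr n y = c + real_of_int k \<and> dotr m y = d + real_of_int l"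
    by blast
qed

text \<open>The points of the slice \<open>n \<bullet> y = 1/2\<close> used here are the corner \<open>y i = h i\<close> of the box,
  moved back along coordinate \<open>p\<close> or \<open>q\<close>.\<close>

lemma covering_corner:
  assumes pq: "p \<in> {1..4}" "q \<in> {1..4}" "n p > 0" "n q > 0" and n0: "\<And>i. i \<in> {1..4} \<Longrightarrow> n i \<ge> 0"
    and h0: "\<And>i. i \<in> {1..4} \<Longrightarrow> h i \<ge> 0"
    and th: "\<theta> = dotr n h - 1/2" "0 \<le> \<theta>" "\<theta> \<le> 2 * h p * of_int (n p)" "\<theta> \<le> 2 * h q * of_int (n q)"
    and D: "\<theta> * (of_int (m p) / of_int (n p) - of_int (m q) / of_int (n q))
      + (\<Sum>i\<in>{1..4}. if n i = 0 then 2 * h i * \<bar>of_int (m i)\<bar> else 0) \<ge> 1"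
  shows "covering n m h"
proof -
  \<comment> \<open>The corner exceeds the slice by \<open>\<theta>\<close>, all of which is taken
    from coordinate \<open>r\<close>. Coordinates with \<open>n i = 0\<close> are free, so their
    signs follow \<open>m\<close> and contribute their full range.\<close>
  define Y where "Y r s = (\<lambda>i. (if n i = 0 then s * sgn (of_int (m i)) * h i else h i) -
     (if i = r then \<theta> / of_int (n r) else 0))" for r and s :: real
  have box: "\<bar>Y r s i\<bar> \<le> h i"
    if "i \<in> {1..4}" "n r > 0" "\<theta> \<le> 2 * h r * of_int (n r)" "s = 1 \<or> s = -1" for r s i
  proof -
    have "0 \<le> \<theta> / of_int (n r)" "\<theta> / of_int (n r) \<le> 2 * h r"
      using that th(2) by (auto simp: pos_divide_le_eq)
    then show ?thesis using that h0[OF that(1)] by (auto simp: Y_def sgn_if abs_le_iff)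
  qed
  have dY: "dotr x (Y r s) = (\<Sum>i\<in>{1..4}. of_int (x i) * (if n i = 0 then s * sgn (of_int (m i)) * h i else h i))
     - of_int (x r) * (\<theta> / of_int (n r))" if "r \<in> {1..4}" for x r s
    using that unfolding dotr_def Y_def
    by (simp add: right_diff_distrib sum_subtractf if_distrib[of "\<lambda>z. _ * z"] cong: if_cong)
  have nY: "dotr n (Y r s) = 1/2" if "r \<in> {1..4}" "n r > 0" for r s
  proof -
    have "(\<Sum>i\<in>{1..4}. of_int (n i) * (if n i = 0 then s * sgn (of_int (m i)) * h i else h i)) = dotr n h"
      unfolding dotr_def by (intro sum.cong) auto
    then show ?thesis unfolding dY[OF that(1)] using that th(1) by simp
  qed
  have "dotr m (Y q 1) - dotr m (Y p (-1)) =
      (\<Sum>i\<in>{1..4}. of_int (m i) * (if n i = 0 then 1 * sgn (of_int (m i)) * h i else h i)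
        - of_int (m i) * (if n i = 0 then (-1) * sgn (of_int (m i)) * h i else h i))
      + \<theta> * (of_int (m p) / of_int (n p) - of_int (m q) / of_int (n q))"
    unfolding dY[OF pq(1)] dY[OF pq(2)] sum_subtractf by (simp add: algebra_simps)
  also have "(\<Sum>i\<in>{1..4}. of_int (m i) * (if n i = 0 then 1 * sgn (of_int (m i)) * h i else h i)
        - of_int (m i) * (if n i = 0 then (-1) * sgn (of_int (m i)) * h i else h i))
      = (\<Sum>i\<in>{1..4}. if n i = 0 then 2 * h i * \<bar>of_int (m i)\<bar> else 0)"
    by (intro sum.cong) (auto simp: sgn_if abs_if)
  finally have "dotr m (Y q 1) - dotr m (Y p (-1)) \<ge> 1" using D by linarith
  then show ?thesis
    using box nY pq th by (intro covering_if_slice[of "Y q 1" h "Y p (-1)"]) auto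
qed

lemma covering_corner_abs:
  assumes pq: "p \<in> {1..4}" "q \<in> {1..4}" "n p > 0" "n q > 0" and n0: "\<And>i. i \<in> {1..4} \<Longrightarrow> n i \<ge> 0"
    and h0: "\<And>i. i \<in> {1..4} \<Longrightarrow> h i \<ge> 0"
    and th: "\<theta> = dotr n h - 1/2" "0 \<le> \<theta>" "\<theta> \<le> 2 * h p * of_int (n p)" "\<theta> \<le> 2 * h q * of_int (n q)"
    and D: "\<theta> * \<bar>of_int (m p) / of_int (n p) - of_int (m q) / of_int (n q)\<bar>
      + (\<Sum>i\<in>{1..4}. if n i = 0 then 2 * h i * \<bar>of_int (m i)\<bar> else 0) \<ge> 1"
  shows "covering n m h"
proof (cases "real_of_int (m q) / of_int (n q) \<le> of_int (m p) / of_int (n p)")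
  case True
  then show ?thesis using covering_corner[OF pq n0 h0 th, of m] D by simp
next
  case False
  then show ?thesis using covering_corner[OF pq(2,1,4,3) n0 h0 th(1,2,4,3), of m] D by simp
qed

subsection \<open>Symmetric convex sets in the plane\<close>

text \<open>The upper boundary of \<open>K\<close> over the abscissa \<open>x\<close> has height at
  least \<open>r\<close>. For convex \<open>K\<close> this boundary is concave, and by symmetry the
  lower boundary at \<open>x\<close> is minus the upper one at \<open>- x\<close>.\<close>

definition reaches :: "(real \<times> real) set \<Rightarrow> real \<Rightarrow> real \<Rightarrow> bool" where
  "reaches K x r \<longleftrightarrow> (\<exists>y\<ge>r. (x, y) \<in> K)"

definition covers_line :: "(real \<times> real) set \<Rightarrow> real \<Rightarrow> bool" where
  "covers_line K x \<longleftrightarrow> (\<forall>b. \<exists>(k::int) (l::int). (x + of_int k, b + of_int l) \<in> K)"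

lemma reachesI: "(x, y) \<in> K \<Longrightarrow> r \<le> y \<Longrightarrow> reaches K x r"
  by (auto simp: reaches_def)

lemma reaches_chord:
  assumes K: "convex K" and "reaches K a p" "reaches K b q" and x: "a < b" "a \<le> x" "x \<le> b"
    and r: "(b - a) * r \<le> (b - x) * p + (x - a) * q"
  shows "reaches K x r"
proof -
  obtain y z where yz: "(a, y) \<in> K" "p \<le> y" "(b, z) \<in> K" "q \<le> z"
    using assms unfolding reaches_def by blast
  define s where "s = (b - x) / (b - a)"
  define t where "t = (x - a) / (b - a)"
  have st: "0 \<le> s" "0 \<le> t" "s + t = 1" "s * (b - a) = b - x" "t * (b - a) = x - a"
    using x by (simp_all add: s_def t_def add_divide_distrib[symmetric])
  have "s *\<^sub>R (a, y) + t *\<^sub>R (b, z) \<in> K"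
    using K yz st unfolding convex_def by blast
  moreover have "s * a + t * b = x"
  proof -
    have "(b - a) * (s * a + t * b) = (s * (b - a)) * a + (t * (b - a)) * b" by (simp add: algebra_simps)
    also have "\<dots> = (b - a) * x" unfolding st by (simp add: algebra_simps)
    finally show ?thesis using x by simp
  qed
  ultimately have "(x, s * y + t * z) \<in> K" by simp
  moreover have "r \<le> s * y + t * z"
  proof -
    have "(b - a) * r \<le> (b - x) * y + (x - a) * z"
      using r mult_left_mono[OF yz(2), of "b - x"] mult_left_mono[OF yz(4), of "x - a"] x by linarith
    also have "\<dots> = (b - a) * (s * y + t * z)" unfolding st(4,5)[symmetric] by (simp add: algebra_simps)
    finally show ?thesis using x by simp
  qed
  ultimately show ?thesis by (rule reachesI)
qed

lemma slice_interval:
  assumes "convex K" "(x, y) \<in> K" "(x, z) \<in> K" "y \<le> b" "b \<le> (z::real)"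
  shows "(x::real, b) \<in> K"
proof (cases "y = z")
  case True
  then show ?thesis using assms by simp
next
  case False
  then have yz: "y < z" using assms by simp
  have "((z - b) / (z - y)) *\<^sub>R (x, y) + ((b - y) / (z - y)) *\<^sub>R (x, z) \<in> K"
    using assms yz by (intro convexD) (auto simp: add_divide_distrib[symmetric])
  moreover have "(z - b) / (z - y) * x + (b - y) / (z - y) * x = x"
    using yz by (simp add: distrib_right[symmetric] add_divide_distrib[symmetric])
  moreover have "(z - b) / (z - y) * y + (b - y) / (z - y) * z = b"
  proof -
    have "(z - b) / (z - y) * y + (b - y) / (z - y) * z = ((z - b) * y + (b - y) * z) / (z - y)"
      by (simp add: add_divide_distrib)
    also have "(z - b) * y + (b - y) * z = b * (z - y)" by (simp add: algebra_simps)
    finally show ?thesis using yz by simp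
  qed
  ultimately show ?thesis by simp
qed

lemma covers_line_direct:
  assumes K: "convex K" "\<And>p. p \<in> K \<Longrightarrow> - p \<in> K"
    and f: "reaches K x p" "reaches K (- x) q" "p + q \<ge> 1"
  shows "covers_line K x"
  unfolding covers_line_def
proof
  fix b
  obtain y z where yz: "(x, y) \<in> K" "p \<le> y" "(- x, z) \<in> K" "q \<le> z"
    using f unfolding reaches_def by blast
  have "(x, - z) \<in> K" using K(2)[OF yz(3)] by simp
  moreover have "- z \<le> b + of_int \<lceil>- z - b\<rceil>" "b + of_int \<lceil>- z - b\<rceil> \<le> y"
    using yz f(3) by linarith+
  ultimately have "(x + of_int 0, b + of_int \<lceil>- z - b\<rceil>) \<in> K" 
    using slice_interval[OF K(1) _ yz(1)] by simp
  then show "\<exists>(k::int) (l::int). (x + of_int k, b + of_int l) \<in> K" by blast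
qed

text \<open>The length of the slice at \<open>x\<close> is the upper boundary at \<open>x\<close>
  plus that at \<open>- x\<close>. This is even and concave, so on nonnegative \<open>x\<close> it
  does not increase.\<close>

lemma covers_line_upto:
  assumes K: "convex K" "\<And>p. p \<in> K \<Longrightarrow> - p \<in> K"
    and f: "reaches K b p" "reaches K (- b) q" "p + q \<ge> 1" and x: "0 \<le> x" "x \<le> b" "b > 0"
  shows "covers_line K x"
proof (rule covers_line_direct[OF K])
  show "reaches K x (((b + x) * p + (b - x) * q) / (2 * b))"
    using x by (intro reaches_chord[OF K(1) f(2) f(1)]) (auto simp: add.commute)
  show "reaches K (- x) (((b - x) * p + (b + x) * q) / (2 * b))"
    using x by (intro reaches_chord[OF K(1) f(2) f(1)]) (auto simp: add.commute)
  have "((b + x) * p + (b - x) * q) / (2 * b) + ((b - x) * p + (b + x) * q) / (2 * b) = p + q"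
    using x by (simp add: field_simps)
  then show "((b + x) * p + (b - x) * q) / (2 * b) + ((b - x) * p + (b + x) * q) / (2 * b) \<ge> 1"
    using f by simp
qed

text \<open>Shift the slice at \<open>x - 1\<close> up by 1. The first inequality says that it
  begins no higher than the slice at \<open>x\<close> ends, the second that from the bottom of the
  slice at \<open>x\<close> to its top there is at least length 1.\<close>

lemma covers_line_glue:
  assumes K: "convex K" "\<And>p. p \<in> K \<Longrightarrow> - p \<in> K"
    and f: "reaches K x p" "reaches K (1 - x) q" "p + q \<ge> 1"
      "reaches K (- x) p'" "reaches K (x - 1) q'" "p' + q' \<ge> 0"
  shows "covers_line K x"
  unfolding covers_line_def
proof
  fix b
  obtain y1 y2 y3 y4 where y: "(x, y1) \<in> K" "p \<le> y1" "(1 - x, y2) \<in> K" "q \<le> y2"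
    "(- x, y3) \<in> K" "p' \<le> y3" "(x - 1, y4) \<in> K" "q' \<le> y4"
    using f unfolding reaches_def by meson
  have neg: "(x, - y3) \<in> K" "(x - 1, - y2) \<in> K" using K(2)[OF y(5)] K(2)[OF y(3)] by simp_all
  define l where "l = \<lceil>- y3 - b\<rceil>"
  have l: "- y3 \<le> b + of_int l" "b + of_int l \<le> 1 - y3" unfolding l_def by linarith+
  show "\<exists>(k::int) (l::int). (x + of_int k, b + of_int l) \<in> K"
  proof (cases "b + of_int l \<le> y1")
    case True
    then have "(x + of_int 0, b + of_int l) \<in> K"
      using slice_interval[OF K(1) neg(1) y(1)] l by simp
    then show ?thesis by blast
  next
    case False
    then have "- y2 \<le> b + of_int (l - 1)" "b + of_int (l - 1) \<le> y4"
      using l y f by auto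
    then have "(x + of_int (-1), b + of_int (l - 1)) \<in> K"
      using slice_interval[OF K(1) neg(2) y(7)] by simp
    then show ?thesis by blast
  qed
qed

text \<open>Up to a change of basis and scaling, the points assumed here exist when \<open>K\<close> has width at least
  \<open>2\<close> in the directions \<open>(1,0)\<close>, \<open>(0,1)\<close> and \<open>(-1,1)\<close>. A vertical line is covered either by
  its own slice of \<open>K\<close> or by gluing the slices at \<open>x\<close> and \<open>x - 1\<close>.\<close>

lemma symmetric_convex_covers_half:
  assumes K: "convex K" "\<And>p. p \<in> K \<Longrightarrow> - p \<in> K"
    and P1: "(1, y0) \<in> K" "0 \<le> y0" "y0 \<le> 1/2"
    and P2: "(x0, 1) \<in> K" "\<bar>x0\<bar> \<le> 1"
    and P3: "(u, 1 + u) \<in> K" "\<bar>u\<bar> \<le> 1"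
    and x: "0 \<le> x" "x \<le> 1/2"
  shows "covers_line K x"
proof -
  have r1: "reaches K 1 y0" using P1(1) by (rule reachesI) simp
  have rm1: "reaches K (-1) (- y0)" using K(2)[OF P1(1)] by (intro reachesI[of _ "- y0"]) auto
  have r2: "reaches K x0 1" using P2(1) by (rule reachesI) simp
  have r3: "reaches K u (1 + u)" using P3(1) by (rule reachesI) simp
  note chord = reaches_chord[OF K(1)]
  \<comment> \<open>Slices only get longer towards 0, so length 1 at \<open>1/2\<close> settles all
    \<open>x\<close>.\<close>
  have half: ?thesis if "reaches K (1/2) p" "reaches K (-1/2) q" "p + q \<ge> 1" for p q
    using covers_line_upto[OF K that(1), of q x] that x by simp
  consider "u \<ge> 0" | "x0 \<le> 0" | "u < 0" "0 < x0" "x0 \<le> 1/2" | "u < 0" "x0 > 1/2" by linarith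
  then show ?thesis
  proof cases
    case 1
    define q where "q = 1/2 - y0 + y0 / (2 * (1 + u))"
    have u1: "(1 + u) * q = (1 + u) * (1/2 - y0) + y0 / 2"
      using 1 by (simp add: q_def field_simps)
    have "reaches K (-1/2) q"
      by (rule chord[OF rm1 r3]) (use 1 u1 in \<open>simp_all add: field_simps\<close>)
    have y0u: "y0 / (2 * (1 + u)) \<ge> y0 / 4"
      using 1 P1 P3 by (intro divide_left_mono) auto
    show ?thesis
    proof (cases "u \<le> 1/2")
      case True
      have "reaches K (1/2) ((1 + u + y0) / 2)"
      proof (rule chord[OF r3 r1])
        have "u * y0 \<le> u * (1 + u)" using 1 P1 by (intro mult_left_mono) auto
        then show "(1 - u) * ((1 + u + y0) / 2) \<le> (1 - 1/2) * (1 + u) + (1/2 - u) * y0"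
          by (simp add: field_simps)
      qed (use 1 True in auto)
      moreover have "(1 + u + y0) / 2 + q \<ge> 1"
      proof -
        have "(1 + u) * ((1 + u + y0) / 2 + q - 1) = (u * (1 + u) - y0 * u) / 2"
          unfolding distrib_left right_diff_distrib u1 by (simp add: field_simps)
        also have "\<dots> \<ge> 0" 
        proof -
          have "u * (1 + u - y0) \<ge> 0" using 1 P1 by (intro mult_nonneg_nonneg) auto
          then show ?thesis by (simp add: algebra_simps)
        qed
        finally show ?thesis using 1 by (simp add: zero_le_mult_iff)
      qed
      ultimately show ?thesis using half \<open>reaches K (-1/2) q\<close> by blast
    next
      case False
      have "reaches K (1/2) 1"
      proof (rule chord[OF rm1 r3])
        have uy: "u * y0 \<le> u * (1/2)" using 1 P1 by (intro mult_left_mono) auto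
        show "(u - - 1) * 1 \<le> (u - 1/2) * - y0 + (1/2 - - 1) * (1 + u)" 
        proof -
          have "(u - 1/2) * - y0 + (1/2 - - 1) * (1 + u) - (u - - 1) * 1 = 1/2 + u/2 + y0/2 - u * y0"
            by (simp add: field_simps)
          then show ?thesis using uy P1 1 by linarith
        qed
      qed (use 1 False in auto)
      moreover have "1 + q \<ge> 1" using y0u P1 by (simp add: q_def)
      ultimately show ?thesis using half \<open>reaches K (-1/2) q\<close> by blast
    qed
  next
    case 2
    show ?thesis
    proof (cases "x0 \<le> -1/2")
      case True
      have y0x': "(-1) * (1 - y0) \<le> x0 * (1 - y0)" using P1 P2 by (intro mult_right_mono) auto
      have "reaches K (1/2) (1/4 + 3/4 * y0)"
        by (rule chord[OF r2 r1]) (use True P1 y0x' in \<open>simp_all add: algebra_simps add_divide_distrib diff_divide_distrib\<close>)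
      moreover have "reaches K (-1/2) (3/4 + 1/4 * y0)"
        by (rule chord[OF r2 r1]) (use True P1 y0x' in \<open>simp_all add: algebra_simps add_divide_distrib diff_divide_distrib\<close>)
      ultimately show ?thesis using half[of "1/4 + 3/4 * y0" "3/4 + 1/4 * y0"] P1 by simp
    next
      case False
      define p where "p = y0 + (1 - y0) / (2 * (1 - x0))"
      define q where "q = - y0 + (1 + y0) / (2 * (1 + x0))"
      have p: "(1 - x0) * p = (1 - x0) * y0 + (1 - y0) / 2" using 2 by (simp add: p_def field_simps)
      have q: "(1 + x0) * q = - ((1 + x0) * y0) + (1 + y0) / 2" using False by (simp add: q_def field_simps)
      have "reaches K (1/2) p"
        by (rule chord[OF r2 r1]) (use 2 False p in \<open>simp_all add: field_simps\<close>)
      moreover have "reaches K (-1/2) q"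
        by (rule chord[OF rm1 r2]) (use 2 False q in \<open>simp_all add: field_simps\<close>)
      moreover have "p + q \<ge> 1"
      proof -
        have pos: "(1 - x0) * (1 + x0) > 0" using 2 False by (intro mult_pos_pos) auto
        have "(1 - x0) * (1 + x0) * (p + q - 1) = (1 + x0) * ((1 - x0) * p) + (1 - x0) * ((1 + x0) * q) - (1 - x0) * (1 + x0)"
          by (simp add: algebra_simps)
        also have "\<dots> = x0 * x0 - x0 * y0" unfolding p q by (simp add: field_simps)
        also have "\<dots> \<ge> 0" using 2 P1 by (simp add: mult_left_mono_neg)
        finally show ?thesis using pos by (simp add: zero_le_mult_iff)
      qed
      ultimately show ?thesis using half by blast
    qed
  next
    case 3
    define p where "p = y0 + (1 - y0) / (2 * (1 - x0))"
    have p: "(1 - x0) * p = (1 - x0) * y0 + (1 - y0) / 2" using 3 by (simp add: p_def field_simps)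
    have rp: "reaches K (1/2) p"
      by (rule chord[OF r2 r1]) (use 3 p in \<open>simp_all add: field_simps\<close>)
    show ?thesis
    proof (cases "u \<ge> -1/2")
      case True
      have "reaches K (-1/2) ((1 - y0) / 2)"
      proof (rule chord[OF rm1 r3])
        have "y0 * u \<le> 0" using 3 P1 by (simp add: mult_nonneg_nonpos)
        then show "(u - - 1) * ((1 - y0) / 2) \<le> (u - -1/2) * - y0 + (-1/2 - - 1) * (1 + u)"
          by (simp add: field_simps)
      qed (use True 3 in auto)
      moreover have "p + (1 - y0) / 2 \<ge> 1"
      proof -
        have "(1 - x0) * (p + (1 - y0) / 2 - 1) = (1 - x0) * p + (1 - x0) * ((1 - y0) / 2 - 1)"
          by (simp add: algebra_simps)
        also have "\<dots> = x0 * (1 - y0) / 2" unfolding p by (simp add: field_simps)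
        also have "\<dots> \<ge> 0" using 3 P1 by simp
        finally show ?thesis using 3 by (simp add: zero_le_mult_iff)
      qed
      ultimately show ?thesis using half rp by blast
    next
      case False
      define q where "q = 1 / (2 * (1 + x0))"
      have q: "(1 + x0) * q = 1/2" using 3 by (simp add: q_def field_simps)
      have "reaches K (-1/2) q"
      proof (rule chord[OF r3 r2])
        have "(1 + x0) * ((x0 - u) * q) = (x0 - u) * ((1 + x0) * q)" by (simp add: algebra_simps)
        also have "\<dots> = (x0 - u) / 2" unfolding q by simp
        also have "\<dots> \<le> (1 + x0) * ((x0 - -1/2) * (1 + u) + (-1/2 - u) * 1)"
        proof -
          have "0 \<le> x0 * (1 + u)" "0 \<le> x0 * (x0 * (1 + u))" using 3 P3 by simp_all
          then show ?thesis by (simp add: field_simps)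
        qed
        finally show "(x0 - u) * q \<le> (x0 - -1/2) * (1 + u) + (-1/2 - u) * 1"
          using 3 by simp
      qed (use False 3 in auto)
      moreover have "p + q \<ge> 1"
      proof -
        have pos: "(1 - x0) * (1 + x0) > 0" using 3 by (intro mult_pos_pos) auto
        have "(1 - x0) * (1 + x0) * (p + q - 1) = (1 + x0) * ((1 - x0) * p) + (1 - x0) * ((1 + x0) * q) - (1 - x0) * (1 + x0)"
          by (simp add: algebra_simps)
        also have "\<dots> = x0 * x0 + (1 + x0) * (1 - 2 * x0) * y0 / 2" unfolding p q by (simp add: field_simps)
        also have "\<dots> \<ge> 0" using 3 P1 by simp
        finally show ?thesis using pos by (simp add: zero_le_mult_iff)
      qed
      ultimately show ?thesis using half rp by blast
    qed
  next
    case 4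
    define b where "b = 1 - x0"
    have b: "0 \<le> b" "b < 1/2" "b < x0" using 4 P2 by (auto simp: b_def)
    have xu: "0 \<le> x0 * (1 + u)" "u * (1 - x0) \<le> 0"
      using 4 P2 P3 by (simp_all add: mult_nonpos_nonneg)
    have xu': "0 \<le> x0 - u + 2 * (u * x0)"
    proof -
      have "x0 * (1 + u) - u * (1 - x0) = x0 - u + 2 * (u * x0)" by (simp add: algebra_simps)
      then show ?thesis using xu by linarith
    qed
    show ?thesis
    proof (cases "x \<le> b")
      case False
      \<comment> \<open>The abscissas \<open>b\<close> and \<open>x0 = 1 - b\<close> are symmetric
        about \<open>1/2\<close>, with heights 0 and 1. The chord between them therefore has heights
        at \<open>x\<close> and \<open>1 - x\<close> that add up to exactly 1. On the other side the
        chord from \<open>-1\<close> to 0 is used.\<close>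
      have rb: "reaches K b 0"
        by (rule chord[OF r3 r2]) (use 4 b P3 in \<open>auto intro!: add_nonneg_nonneg mult_nonneg_nonneg\<close>)
      have r0: "reaches K 0 (1/2)"
        by (rule chord[OF r3 r2]) (use 4 xu' in \<open>simp_all add: algebra_simps add_divide_distrib diff_divide_distrib\<close>)
      have "reaches K x ((x - b) / (x0 - b))"
        by (rule chord[OF rb r2]) (use b False x 4 in auto)
      moreover have "reaches K (1 - x) ((1 - x - b) / (x0 - b))"
        by (rule chord[OF rb r2]) (use b False x 4 in \<open>auto simp: b_def\<close>)
      moreover have "(x - b) / (x0 - b) + (1 - x - b) / (x0 - b) \<ge> 1"
        using b by (simp add: add_divide_distrib[symmetric] b_def)
      moreover have "reaches K (- x) (1/2 - x)"
      proof (rule chord[OF rm1 r0])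
        have "x * y0 \<le> x * (1/2)" using x P1 by (intro mult_left_mono) auto
        then show "(0 - - 1) * (1/2 - x) \<le> (0 - - x) * - y0 + (- x - - 1) * (1/2)" by (simp add: algebra_simps)
      qed (use x in auto)
      moreover have "reaches K (x - 1) (x - 1/2)"
      proof (rule chord[OF rm1 r0])
        have "(1 - x) * y0 \<le> (1 - x) * (1/2)" using x P1 by (intro mult_left_mono) auto
        then show "(0 - - 1) * (x - 1/2) \<le> (0 - (x - 1)) * - y0 + (x - 1 - - 1) * (1/2)" by (simp add: algebra_simps)
      qed (use x in auto)
      ultimately show ?thesis by (intro covers_line_glue[OF K]) auto
    next
      case True
      show ?thesis
      proof (cases "- u \<ge> b")
        case True
        define s where "s = - u / (x0 - u)"
        have s: "(x0 - u) * s = - u" using 4 by (simp add: s_def)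
        have "reaches K b (1 - s * (2 * x0 - 1))"
        proof (rule chord[OF r3 r2])
          have "(x0 - u) * (1 - s * (2 * x0 - 1)) = (x0 - u) - ((x0 - u) * s) * (2 * x0 - 1)"
            by (simp add: algebra_simps)
          also have "\<dots> = (x0 - b) * (1 + u) + (b - u) * 1" unfolding s by (simp add: b_def algebra_simps)
          finally show "(x0 - u) * (1 - s * (2 * x0 - 1)) \<le> (x0 - b) * (1 + u) + (b - u) * 1" by simp
        qed (use b 4 in auto)
        moreover have "reaches K (- b) (1 - s)"
        proof (rule chord[OF r3 r2])
          have "(x0 - u) * (1 - s) = (x0 - u) - (x0 - u) * s" by (simp add: algebra_simps)
          also have "\<dots> = (x0 - - b) * (1 + u) + (- b - u) * 1" unfolding s by (simp add: b_def algebra_simps)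
          finally show "(x0 - u) * (1 - s) \<le> (x0 - - b) * (1 + u) + (- b - u) * 1" by simp
        qed (use b 4 True in auto)
        moreover have "1 - s * (2 * x0 - 1) + (1 - s) \<ge> 1"
        proof -
          have "(x0 - u) * (1 - s * (2 * x0 - 1) + (1 - s) - 1) = (x0 - u) - ((x0 - u) * s) * (2 * x0)"
            by (simp add: algebra_simps)
          also have "\<dots> \<ge> 0" unfolding s using xu' by (simp add: algebra_simps)
          finally show ?thesis using 4 by (simp add: zero_le_mult_iff)
        qed
        ultimately show ?thesis
          using covers_line_upto[OF K, of b _ _ x] covers_line_direct[OF K, of x] x \<open>x \<le> b\<close>
          by (cases "b = 0") auto
      next
        case False
        have b0: "b > 0" using False 4 by simp
        have ub: "0 \<le> 1 + u - x0" using False by (simp add: b_def)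
        have "reaches K b (1 - (1 - x0) * (2 * x0 - 1))"
        proof (rule chord[OF r3 r2])
          have "0 \<le> (2 * x0 - 1) * (x0 * (1 + u - x0))" using 4 ub by simp
          then show "(x0 - u) * (1 - (1 - x0) * (2 * x0 - 1)) \<le> (x0 - b) * (1 + u) + (b - u) * 1"
            by (simp add: b_def algebra_simps)
        qed (use b 4 in auto)
        moreover have "reaches K (- b) (x0 - (1 - x0) / 2)"
        proof (rule chord[OF rm1 r3])
          have "(1 + u - x0) * y0 \<le> (1 + u - x0) * (1/2)" using ub P1 by (intro mult_left_mono) auto
          then show "(u - - 1) * (x0 - (1 - x0) / 2) \<le> (u - - b) * - y0 + (- b - - 1) * (1 + u)"
            using mult_nonpos_nonneg[of u x0] 4 by (simp add: b_def field_simps)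
        qed (use b 4 False P3 in \<open>auto simp: b_def\<close>)
        moreover have "1 - (1 - x0) * (2 * x0 - 1) + (x0 - (1 - x0) / 2) \<ge> 1"
        proof -
          have "0 \<le> (x0 - 3/8) * (x0 - 3/8)" by simp
          then show ?thesis by (simp add: field_simps)
        qed
        ultimately show ?thesis using covers_line_upto[OF K] x \<open>x \<le> b\<close> b0 by blast
      qed
    qed
  qed
qed

lemma symmetric_convex_covers:
  fixes a b :: real
  assumes K: "convex K" "\<And>p. p \<in> K \<Longrightarrow> - p \<in> K"
    and P: "(1, y0) \<in> K" "0 \<le> y0" "y0 \<le> 1/2" "(x0, 1) \<in> K" "\<bar>x0\<bar> \<le> 1" "(u, 1 + u) \<in> K" "\<bar>u\<bar> \<le> 1"
  shows "\<exists>(k::int) (l::int). (a + of_int k, b + of_int l) \<in> K"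
proof -
  define r where "r = a - of_int (round a)"
  have r: "- (1/2) \<le> r" "r \<le> 1/2"
    using of_int_round_abs_le[of a] unfolding r_def abs_le_iff by simp_all
  have "\<exists>(k::int) (l::int). (r + of_int k, b + of_int l) \<in> K"
  proof (cases "r \<ge> 0")
    case True
    then show ?thesis
      using symmetric_convex_covers_half[OF K P, of r] r unfolding covers_line_def by blast
  next
    case False
    then obtain k l :: int where "(- r + of_int k, - b + of_int l) \<in> K"
      using symmetric_convex_covers_half[OF K P, of "- r"] r unfolding covers_line_def by fastforce
    from K(2)[OF this] have "(r + of_int (- k), b + of_int (- l)) \<in> K" by simp
    then show ?thesis by blast
  qed
  then obtain k l :: int where "(r + of_int k, b + of_int l) \<in> K" by blast
  then have "(a + of_int (k - round a), b + of_int l) \<in> K" by (simp add: r_def algebra_simps)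
  then show ?thesis by blast
qed

subsection \<open>Speeds without short relations\<close>

lemma orthogonal_ex:
  assumes "\<not> parallel v w"
  shows "\<exists>n. doti n v = 0 \<and> doti n w = 0 \<and> (\<exists>i\<in>{1..4}. n i \<noteq> 0)"
proof -
  obtain a b where ab: "a \<in> {1..4}" "b \<in> {1..4}" "v a * w b \<noteq> v b * w a"
    using assms unfolding parallel_def by blast
  then have "a \<noteq> b" by auto
  then obtain c d where e: "enum4 a b c d" using enum4_ex ab by blast
  have dist: "a \<noteq> b" "a \<noteq> c" "a \<noteq> d" "b \<noteq> c" "b \<noteq> d" "c \<noteq> d"
    using e by (auto simp: enum4_def)
  define n where "n = (\<lambda>i. if i = a then v b * w c - v c * w b else if i = b then v c * w a - v a * w c
    else if i = c then v a * w b - v b * w a else 0)"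
  have "doti n v = 0" "doti n w = 0"
    unfolding doti_def enum4_sum[OF e] n_def using dist by (auto simp: algebra_simps)
  moreover have "n c \<noteq> 0" using dist ab by (simp add: n_def)
  ultimately show ?thesis using enum4_mem[OF e] by blast
qed

lemma onto_pair_shear:
  assumes "onto_pair n m" "s = 1 \<or> s = -1"
  shows "onto_pair n (\<lambda>i. s * m i + k * n i)"
  unfolding onto_pair_def
proof (intro allI)
  fix a b
  obtain z where "doti n z = a" "doti m z = s * (b - k * a)"
    using assms(1) unfolding onto_pair_def by blast
  then show "\<exists>z. doti n z = a \<and> doti (\<lambda>i. s * m i + k * n i) z = b"
    using assms(2) by (intro exI[of _ z]) (auto simp: doti_lincomb)
qed

definition l1 :: "(nat \<Rightarrow> int) \<Rightarrow> int" where
  "l1 n = (\<Sum>i\<in>{1..4}. \<bar>n i\<bar>)"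

lemma l1_pos:
  assumes "i \<in> {1..4}" "n i \<noteq> 0"
  shows "l1 n > 0"
proof -
  have "\<bar>n i\<bar> \<le> l1 n" unfolding l1_def using assms(1) by (intro member_le_sum) auto
  then show ?thesis using assms(2) by simp
qed

text \<open>Dividing \<open>n\<close> by the generator \<open>d\<close> of its values gives a
  relation whose norm is smaller by the factor \<open>d\<close>.\<close>

lemma minimal_imp_primitive:
  assumes n: "doti n v = 0" "doti n w = 0" "i0 \<in> {1..4}" "n i0 \<noteq> 0"
    and min: "\<And>n'. doti n' v = 0 \<Longrightarrow> doti n' w = 0 \<Longrightarrow> (\<exists>i\<in>{1..4}. n' i \<noteq> 0) \<Longrightarrow> l1 n \<le> l1 n'"
  shows "\<exists>z. doti n z = 1"
proof -
  have del: "doti n (\<lambda>j. if j = i then 1 else 0) = n i" if "i \<in> {1..4}" for i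
    using that by (simp add: doti_def if_distrib cong: if_cong)
  have "\<exists>d\<in>range (doti n). d > 0 \<and> (\<forall>x\<in>range (doti n). d dvd x)"
  proof (rule int_subgroup_principal)
    show "n i0 \<in> range (doti n)" using del[OF n(3)] by (metis rangeI)
    show "n i0 \<noteq> 0" by fact
    fix x y q assume "x \<in> range (doti n)" "y \<in> range (doti n)"
    then obtain zx zy where "x = doti n zx" "y = doti n zy" by auto
    then have "x - q * y = doti n (\<lambda>i. 1 * zx i + (- q) * zy i)" by (simp only: doti_lincomb)
    then show "x - q * y \<in> range (doti n)" by simp
  qed
  then obtain d z where d: "d > 0" "d = doti n z" and dvd: "\<And>x. d dvd doti n x" by auto
  define n' where "n' i = n i div d" for i
  have n': "n i = d * n' i" if "i \<in> {1..4}" for i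
    using dvd[of "\<lambda>j. if j = i then 1 else 0"] del[OF that] by (simp add: n'_def)
  have dn': "doti n x = d * doti n' x" for x
    unfolding doti_def sum_distrib_left by (intro sum.cong) (auto simp: n' algebra_simps)
  have ln: "l1 n = d * l1 n'"
    unfolding l1_def sum_distrib_left using d(1) by (intro sum.cong) (auto simp: n' abs_mult)
  have nz: "n' i0 \<noteq> 0" using n' n(3,4) by auto
  have "l1 n \<le> l1 n'"
  proof (rule min)
    show "doti n' v = 0" "doti n' w = 0" using dn' n(1,2) d(1) by (metis mult_eq_0_iff less_irrefl)+
    show "\<exists>i\<in>{1..4}. n' i \<noteq> 0" using nz n(3) by blast
  qed
  moreover have "l1 n' > 0" using l1_pos[of i0 n'] nz n(3) by simp
  ultimately have "d \<le> 1" unfolding ln by simp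
  then show ?thesis using d by (intro exI[of _ z]) simp
qed

lemma abs_dotr_le:
  assumes "\<And>i. i \<in> {1..4} \<Longrightarrow> \<bar>y i\<bar> \<le> H"
  shows "\<bar>dotr n y\<bar> \<le> of_int (l1 n) * H"
proof -
  have "\<bar>dotr n y\<bar> \<le> (\<Sum>i\<in>{1..4}. \<bar>of_int (n i) * y i\<bar>)" unfolding dotr_def by (rule sum_abs)
  also have "\<dots> \<le> (\<Sum>i\<in>{1..4}. \<bar>of_int (n i)\<bar> * H)"
    using assms by (intro sum_mono) (simp add: abs_mult mult_left_mono)
  finally show ?thesis by (simp add: l1_def sum_distrib_right)
qed

lemma dotr_sgn: "dotr n (\<lambda>i. H * of_int (sgn (n i))) = H * of_int (l1 n)"
  unfolding dotr_def l1_def of_int_sum sum_distrib_left by (intro sum.cong) (auto simp: sgn_if)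

lemma dotr_lincomb: "dotr (\<lambda>i. a * n i + b * m i) y = of_int a * dotr n y + of_int b * dotr m y"
  by (simp add: dotr_def sum_distrib_left sum.distrib algebra_simps)

text \<open>A shortest relation \<open>n\<close> of the plane fixes the scale. In the cube of
  half-side \<open>1 / l1 n\<close> every nonzero relation of the plane attains the value 1, by
  minimality, and \<open>n\<close> never exceeds it. Since \<open>l1 n\<close> is at least 5, this
  cube fits into the available box.\<close>

lemma lonely_if_wide:
  fixes t0 :: real
  assumes np: "\<not> parallel v w"
    and eps: "\<And>i. i \<in> {1..4} \<Longrightarrow> \<bar>of_int (w i) - t0 * of_int (v i)\<bar> \<le> 1/5"
    and wide: "\<And>n. doti n v = 0 \<Longrightarrow> (\<exists>i\<in>{1..4}. n i \<noteq> 0) \<Longrightarrow> 5 \<le> l1 n"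
  shows "lonely v"
proof -
  define M where "M = {n. doti n v = 0 \<and> doti n w = 0 \<and> (\<exists>i\<in>{1..4}. n i \<noteq> 0)}"
  obtain n where n: "n \<in> M" and min: "\<And>n'. n' \<in> M \<Longrightarrow> nat (l1 n) \<le> nat (l1 n')"
    using ex_has_least_nat[of "\<lambda>n. n \<in> M" _ "\<lambda>n. nat (l1 n)"] orthogonal_ex[OF np] unfolding M_def by blast
  have l1nn: "l1 x \<ge> 0" for x unfolding l1_def by (intro sum_nonneg) simp
  have min': "l1 n \<le> l1 n'" if "n' \<in> M" for n' using min[OF that] l1nn[of n'] l1nn[of n] by simp
  have orth: "doti n v = 0" "doti n w = 0" using n by (auto simp: M_def)
  obtain z0 where z0: "doti n z0 = 1"
    using minimal_imp_primitive[OF orth] n min' unfolding M_def by blast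
  obtain m0 where m0: "doti m0 v = 0" "doti m0 w = 0" "onto_pair n m0"
    using onto_pair_completion[OF np orth z0] by blast
  have l5: "5 \<le> l1 n" using wide[OF orth(1)] n by (auto simp: M_def)
  define H where "H = 1 / real_of_int (l1 n)"
  have H: "H > 0" "H \<le> 1/5" "H * of_int (l1 n) = 1" using l5 by (auto simp: H_def field_simps)
  define y1 where "y1 i = H * real_of_int (sgn (n i))" for i
  have ny1: "dotr n y1 = 1" unfolding y1_def dotr_sgn by (rule H(3))
  \<comment> \<open>Adding a multiple of \<open>n\<close> to \<open>m0\<close> and flipping its sign
    puts the height of the first point into \<open>[0, 1/2]\<close>.\<close>
  define r where "r = dotr m0 y1 - of_int (round (dotr m0 y1))"
  have r: "\<bar>r\<bar> \<le> 1/2" unfolding r_def using of_int_round_abs_le[of "dotr m0 y1"] by linarith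
  define s where "s = (if r \<ge> 0 then 1 else - 1 :: int)"
  define m where "m i = s * m0 i + (- s * round (dotr m0 y1)) * n i" for i
  have s: "s = 1 \<or> s = -1" by (simp add: s_def)
  have dm: "doti m x = s * doti m0 x + (- s * round (dotr m0 y1)) * doti n x" for x
    unfolding m_def doti_lincomb ..
  have m: "doti m v = 0" "doti m w = 0" unfolding dm using m0 orth by simp_all
  have onto: "onto_pair n m" unfolding m_def by (rule onto_pair_shear[OF m0(3) s])
  have "dotr m y1 = of_int s * dotr m0 y1 + of_int (- s * round (dotr m0 y1)) * dotr n y1"
    unfolding m_def dotr_lincomb ..
  then have "dotr m y1 = of_int s * r" unfolding ny1 r_def by (simp add: algebra_simps)
  then have my1: "dotr m y1 = \<bar>r\<bar>" by (simp add: s_def)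
  have mnz: "\<exists>i\<in>{1..4}. a * n i + b * m i \<noteq> 0" if "b \<noteq> 0" for a b
    using onto_pair_independent[OF onto, of a b] that by blast
  have ge: "1 \<le> H * of_int (l1 x)" if "x \<in> M" for x
  proof -
    have "H * of_int (l1 n) \<le> H * of_int (l1 x)" using min'[OF that] H(1) by (intro mult_left_mono) auto
    then show ?thesis unfolding H(3) .
  qed
  define K where "K = {(dotr n y, dotr m y) | y. \<forall>i\<in>{1..4}. \<bar>y i\<bar> \<le> H}"
  have inK: "(dotr n y, dotr m y) \<in> K" if "\<forall>i\<in>{1..4}. \<bar>y i\<bar> \<le> H" for y
    using that by (auto simp: K_def)
  have conv: "convex K"
    unfolding convex_def
  proof (intro ballI allI impI)
    fix p q and a b :: real
    assume pq: "p \<in> K" "q \<in> K" and ab: "0 \<le> a" "0 \<le> b" "a + b = 1"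
    obtain x y where xy: "p = (dotr n x, dotr m x)" "\<forall>i\<in>{1..4}. \<bar>x i\<bar> \<le> H"
      "q = (dotr n y, dotr m y)" "\<forall>i\<in>{1..4}. \<bar>y i\<bar> \<le> H"
      using pq unfolding K_def by blast
    have "\<bar>a * x i + b * y i\<bar> \<le> H" if i: "i \<in> {1..4}" for i
    proof -
      have "\<bar>a * x i + b * y i\<bar> \<le> a * \<bar>x i\<bar> + b * \<bar>y i\<bar>"
        using ab by (intro order_trans[OF abs_triangle_ineq]) (simp add: abs_mult)
      also have "\<dots> \<le> H" using convex_bound_le[of "\<bar>x i\<bar>" H "\<bar>y i\<bar>" a b] ab xy i by simp
      finally show ?thesis .
    qed
    then have "(dotr n (\<lambda>i. a * x i + b * y i), dotr m (\<lambda>i. a * x i + b * y i)) \<in> K" by (intro inK) blast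
    then show "a *\<^sub>R p + b *\<^sub>R q \<in> K" unfolding xy by (simp add: dotr_add dotr_scale)
  qed
  have sym: "- p \<in> K" if p: "p \<in> K" for p
  proof -
    obtain y where y: "p = (dotr n y, dotr m y)" "\<forall>i\<in>{1..4}. \<bar>y i\<bar> \<le> H"
      using p unfolding K_def by blast
    have "(dotr n (\<lambda>i. (-1) * y i), dotr m (\<lambda>i. (-1) * y i)) \<in> K" using y by (intro inK) simp
    then show ?thesis unfolding dotr_scale y by simp
  qed
  have supp: "\<exists>y. (\<forall>i\<in>{1..4}. \<bar>y i\<bar> \<le> H) \<and> dotr x y = 1" if x: "x \<in> M" for x
  proof (intro exI conjI ballI)
    have pos: "real_of_int (l1 x) > 0" using ge[OF x] H by (smt (verit) zero_less_mult_iff)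
    show "dotr x (\<lambda>i. (1 / of_int (l1 x)) * of_int (sgn (x i))) = 1" unfolding dotr_sgn using pos by simp
    fix i :: nat
    have "1 / real_of_int (l1 x) \<le> H" using ge[OF x] pos by (simp add: pos_divide_le_eq)
    then show "\<bar>1 / of_int (l1 x) * real_of_int (sgn (x i))\<bar> \<le> H" using pos H by (auto simp: sgn_if)
  qed
  have nle: "\<bar>dotr n y\<bar> \<le> 1" if "\<forall>i\<in>{1..4}. \<bar>y i\<bar> \<le> H" for y
    using abs_dotr_le[of y H n] that H by (simp add: mult.commute)
  have P1: "(1, \<bar>r\<bar>) \<in> K"
  proof -
    have "\<forall>i\<in>{1..4}. \<bar>y1 i\<bar> \<le> H" using H by (auto simp: y1_def sgn_if)
    from inK[OF this] show ?thesis unfolding ny1 my1 .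
  qed
  have "m \<in> M" using m mnz[of 1 0] by (simp add: M_def)
  then obtain y2 where y2: "\<forall>i\<in>{1..4}. \<bar>y2 i\<bar> \<le> H" "dotr m y2 = 1" using supp by blast
  \<comment> \<open>The value 1 of \<open>m - n\<close> at \<open>y3\<close> gives the point on the
    line of height \<open>1 + u\<close>, the third direction needed by
    \<open>symmetric_convex_covers\<close>.\<close>
  have "(\<lambda>i. (-1) * n i + 1 * m i) \<in> M"
    using m orth mnz[of 1 "-1"] unfolding M_def by (simp only: doti_lincomb mem_Collect_eq) simp
  then obtain y3 where y3: "\<forall>i\<in>{1..4}. \<bar>y3 i\<bar> \<le> H" "dotr (\<lambda>i. (-1) * n i + 1 * m i) y3 = 1" using supp by blast
  have "dotr m y3 = 1 + dotr n y3" using y3(2) unfolding dotr_lincomb by simp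
  then have P3: "(dotr n y3, 1 + dotr n y3) \<in> K" using inK[OF y3(1)] by simp
  have P2: "(dotr n y2, 1) \<in> K" using inK[OF y2(1)] y2(2) by simp
  have "covering n m (\<lambda>i. 3/10 - (1/5) / 2)"
    unfolding covering_def
  proof (intro allI)
    fix c d :: real
    obtain k l :: int where "(c + of_int k, d + of_int l) \<in> K"
      using symmetric_convex_covers[OF conv sym P1 _ _ P2 _ P3, of c d] r nle[OF y2(1)] nle[OF y3(1)] by auto
    then obtain y where "\<forall>i\<in>{1..4}. \<bar>y i\<bar> \<le> H" "dotr n y = c + of_int k" "dotr m y = d + of_int l"
      unfolding K_def by auto
    moreover have "\<forall>i\<in>{1..4}. \<bar>y i\<bar> \<le> 3/10 - (1/5) / 2"
    proof
      fix i :: nat assume "i \<in> {1..4}"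
      with calculation(1) have "\<bar>y i\<bar> \<le> H" by blast
      then show "\<bar>y i\<bar> \<le> 3/10 - (1/5) / 2" using H by simp
    qed
    ultimately show "\<exists>y k l. (\<forall>i\<in>{1..4}. \<bar>y i\<bar> \<le> 3/10 - (1/5) / 2) \<and> dotr n y = c + real_of_int k \<and> dotr m y = d + real_of_int l"
      by blast
  qed
  then show ?thesis using lonely_if_covering[OF np onto orth m, of t0 "\<lambda>i. 1/5"] eps by simp
qed

subsection \<open>Speeds with a short relation\<close>

definition quad :: "nat \<Rightarrow> nat \<Rightarrow> nat \<Rightarrow> 'a \<Rightarrow> 'a \<Rightarrow> 'a \<Rightarrow> 'a \<Rightarrow> nat \<Rightarrow> 'a" where
  "quad i j k a b c d x = (if x = i then a else if x = j then b else if x = k then c else d)"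

lemma quad_simps:
  assumes "enum4 i j k l"
  shows "quad i j k a b c d i = a" "quad i j k a b c d j = b" "quad i j k a b c d k = c" "quad i j k a b c d l = d"
  using assms by (auto simp: quad_def enum4_def)

lemma enum4_nonneg:
  assumes "enum4 i j k l" "0 \<le> H i" "0 \<le> H j" "0 \<le> H k" "0 \<le> (H l :: real)" "x \<in> {1..4}"
  shows "0 \<le> H x"
  using assms by (auto simp: enum4_def)

lemma covering_two_parallel:
  assumes e: "enum4 i j k l" and q: "q > 0"
    and H: "0 \<le> H i" "0 \<le> H j" "0 \<le> H k" "0 \<le> H l"
    and th: "\<theta> = of_int q * H i + H j - 1/2" "0 \<le> \<theta>" "\<theta> \<le> 2 * H j" "\<theta> \<le> 2 * of_int q * H i"
    and m: "m j = 0"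
    and D: "\<theta> * of_int \<bar>m i\<bar> / of_int q + 2 * H k * of_int \<bar>m k\<bar> + 2 * H l * of_int \<bar>m l\<bar> \<ge> 1"
  shows "covering (quad i j k q 1 0 0) m H"
proof -
  define n where "n = quad i j k q 1 0 0"
  have n: "n i = q" "n j = 1" "n k = 0" "n l = 0"
    unfolding n_def by (simp_all add: quad_simps[OF e])
  have sm: "(\<Sum>x\<in>{1..4}. if n x = 0 then 2 * H x * \<bar>of_int (m x)\<bar> else 0)
      = 2 * H k * of_int \<bar>m k\<bar> + 2 * H l * of_int \<bar>m l\<bar>"
    unfolding enum4_sum[OF e] n using q m by auto
  have "covering n m H"
  proof (rule covering_corner_abs[of i j])
    show "i \<in> {1..4}" "j \<in> {1..4}" using enum4_mem[OF e] by blast+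
    show "0 < n i" "0 < n j" using q n by auto
    show "n x \<ge> 0" for x using q by (auto simp: n_def quad_def)
    show "H x \<ge> 0" if "x \<in> {1..4}" for x using enum4_nonneg[OF e H that] .
    show "\<theta> = dotr n H - 1/2" unfolding dotr_def enum4_sum[OF e] n th by simp
    show "0 \<le> \<theta>" "\<theta> \<le> 2 * H i * of_int (n i)" "\<theta> \<le> 2 * H j * of_int (n j)"
      using th n by (simp_all add: mult.assoc mult.commute)
    have "\<bar>real_of_int (m i) / of_int (n i) - of_int (m j) / of_int (n j)\<bar> = of_int \<bar>m i\<bar> / of_int q"
      using q n m by (auto simp: abs_divide)
    then show "\<theta> * \<bar>of_int (m i) / of_int (n i) - of_int (m j) / of_int (n j)\<bar>
      + (\<Sum>x\<in>{1..4}. if n x = 0 then 2 * H x * \<bar>of_int (m x)\<bar> else 0) \<ge> 1"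
      unfolding sm using D by simp
  qed
  then show ?thesis by (simp add: n_def)
qed

text \<open>The three candidates for \<open>r\<close> are the differences of \<open>m / n\<close>
  over the coordinates \<open>i, j, k\<close>, which have this form because \<open>m k = 0\<close>;
  the corner may be moved back along any two of the three.\<close>

lemma covering_triple:
  assumes e: "enum4 i j k l"
    and H: "0 \<le> H i" "0 \<le> H j" "0 \<le> H k" "0 \<le> H l"
    and n: "n = quad i j k c 1 1 d" "c > 0" "d \<ge> 0"
    and th: "\<theta> = of_int c * H i + H j + H k + of_int d * H l - 1/2" "0 \<le> \<theta>" "\<theta> \<le> 2 * H i * of_int c" "\<theta> \<le> 2 * H j" "\<theta> \<le> 2 * H k"
    and m: "m k = 0"
    and D: "max (\<bar>of_int (m i) / of_int c\<bar>) (max (of_int \<bar>m j\<bar>) (\<bar>of_int (m i) / of_int c - of_int (m j)\<bar>)) \<ge> r"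
       "\<theta> * r + (if d = 0 then 2 * H l * of_int \<bar>m l\<bar> else 0) \<ge> 1"
  shows "covering n m H"
proof -
  have n': "n i = c" "n j = 1" "n k = 1" "n l = d"
    unfolding n by (simp_all add: quad_simps[OF e])
  have sm: "(\<Sum>x\<in>{1..4}. if n x = 0 then 2 * H x * \<bar>of_int (m x)\<bar> else 0)
      = (if d = 0 then 2 * H l * of_int \<bar>m l\<bar> else 0)"
    unfolding enum4_sum[OF e] n' using n by auto
  have "\<exists>p\<in>{i, j, k}. \<exists>q\<in>{i, j, k}. r \<le> \<bar>of_int (m p) / of_int (n p) - of_int (m q) / of_int (n q)\<bar>"
    using D(1) n' m by (auto simp: le_max_iff_disj)
  then obtain p q where pq: "p \<in> {i, j, k}" "q \<in> {i, j, k}"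
    "r \<le> \<bar>of_int (m p) / of_int (n p) - of_int (m q) / of_int (n q)\<bar>" by blast
  show ?thesis
  proof (rule covering_corner_abs[of p q])
    show "p \<in> {1..4}" "q \<in> {1..4}" using enum4_mem[OF e] pq by blast+
    show "0 < n p" "0 < n q" using pq n n' by auto
    show "n x \<ge> 0" for x using n by (auto simp: quad_def)
    show "H x \<ge> 0" if "x \<in> {1..4}" for x using enum4_nonneg[OF e H that] .
    show "\<theta> = dotr n H - 1/2" unfolding dotr_def enum4_sum[OF e] n' th by simp
    show "0 \<le> \<theta>" "\<theta> \<le> 2 * H p * of_int (n p)" "\<theta> \<le> 2 * H q * of_int (n q)"
      using th n' pq by auto
    have "\<theta> * r \<le> \<theta> * \<bar>of_int (m p) / of_int (n p) - of_int (m q) / of_int (n q)\<bar>"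
      using pq(3) th(2) by (rule mult_left_mono)
    then show "\<theta> * \<bar>of_int (m p) / of_int (n p) - of_int (m q) / of_int (n q)\<bar>
      + (\<Sum>x\<in>{1..4}. if n x = 0 then 2 * H x * \<bar>of_int (m x)\<bar> else 0) \<ge> 1"
      unfolding sm using D(2) by simp
  qed
qed

text \<open>Speeds of either sign are allowed, so that a given relation can be written with
  nonnegative coefficients. Nonzero speeds with distinct absolute values are encoded in
  \<open>no2\<close>. The index \<open>z\<close> marks the coordinate with the coarser
  error.\<close>

locale runners =
  fixes v u w :: "nat \<Rightarrow> int" and t0 :: real and z :: nat
  assumes bez: "doti u v = 1" and np: "\<not> parallel v w"
    and eps: "\<And>i. i \<in> {1..4} \<Longrightarrow> \<bar>of_int (w i) - t0 * of_int (v i)\<bar> \<le> (if i = z then 1/5 else 1/6)"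
    and z: "z \<in> {1..4}"
    and total: "196 \<le> l1 v"
    and no2: "\<And>n. doti n v = 0 \<Longrightarrow> \<exists>i\<in>{1..4}. n i \<noteq> 0 \<Longrightarrow> 3 \<le> l1 n"
begin

definition h :: "nat \<Rightarrow> real" where
  "h i = 3/10 - (if i = z then 1/5 else 1/6) / 2"

lemma h_cases:
  assumes "enum4 i j k l"
  shows "h i = 1/5 \<and> h j = 13/60 \<and> h k = 13/60 \<and> h l = 13/60 \<or>
    h i = 13/60 \<and> h j = 1/5 \<and> h k = 13/60 \<and> h l = 13/60 \<or>
    h i = 13/60 \<and> h j = 13/60 \<and> h k = 1/5 \<and> h l = 13/60 \<or>
    h i = 13/60 \<and> h j = 13/60 \<and> h k = 13/60 \<and> h l = 1/5"
  using assms z unfolding enum4_def by (auto simp: h_def)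

lemma relation_wide:
  assumes e: "enum4 i j k l" and rel: "a * v i + b * v j + c * v k + d * v l = 0"
    and nz: "a \<noteq> 0 \<or> b \<noteq> 0 \<or> c \<noteq> 0 \<or> d \<noteq> 0"
    and N: "\<And>n. doti n v = 0 \<Longrightarrow> \<exists>i\<in>{1..4}. n i \<noteq> 0 \<Longrightarrow> N \<le> l1 n"
  shows "N \<le> \<bar>a\<bar> + \<bar>b\<bar> + \<bar>c\<bar> + \<bar>d\<bar>"
proof -
  have "doti (quad i j k a b c d) v = 0"
    unfolding doti_def enum4_sum[OF e] quad_simps[OF e] by (fact rel)
  moreover have "\<exists>x\<in>{1..4}. quad i j k a b c d x \<noteq> 0"
    using nz quad_simps[OF e] enum4_mem[OF e] by metis
  ultimately have "N \<le> l1 (quad i j k a b c d)" by (rule N)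
  then show ?thesis unfolding l1_def enum4_sum[OF e] quad_simps[OF e] .
qed

lemma v_nonzero:
  assumes "i \<in> {1..4}"
  shows "v i \<noteq> 0"
proof
  assume v0: "v i = 0"
  define j where "j = (if i = 1 then 2 else 1 :: nat)"
  have "j \<in> {1..4}" "i \<noteq> j" by (auto simp: j_def)
  then obtain k l where e: "enum4 i j k l" using enum4_ex assms by blast
  show False using relation_wide[OF e, of 1 0 0 0 3] no2 v0 by simp
qed

text \<open>As \<open>n\<close> is orthogonal to \<open>v\<close>, the integer
  \<open>doti n w\<close> is \<open>n\<close> applied to the error, so it is smaller than 1 in
  absolute value and vanishes. Thus \<open>n\<close> is one normal of the plane. The entry 1 at
  \<open>s\<close> makes it primitive and allows the other normal to be reduced modulo
  \<open>n\<close> to 0 at \<open>s\<close>.\<close>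

lemma reduce:
  assumes s: "s \<in> {1..4}" "n s = 1" and n: "doti n v = 0" "\<And>i. i \<in> {1..4} \<Longrightarrow> n i \<ge> 0"
    and small: "(\<Sum>i\<in>{1..4}. of_int (n i) * (if i = z then 1/5 else 1/6 :: real)) < 1"
  shows "\<exists>m. doti m v = 0 \<and> onto_pair n m \<and> m s = 0 \<and> (covering n m h \<longrightarrow> lonely v)"
proof -
  have "of_int (doti n w) = dotr n (\<lambda>i. of_int (w i) - t0 * of_int (v i))"
    unfolding dotr_diff dotr_scale dotr_of_int n by simp
  also have "\<bar>\<dots>\<bar> \<le> (\<Sum>i\<in>{1..4}. of_int (n i) * (if i = z then 1/5 else 1/6 :: real))"
    unfolding dotr_def
  proof (rule order_trans[OF sum_abs], rule sum_mono)
    fix i :: nat assume i: "i \<in> {1..4}"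
    show "\<bar>of_int (n i) * (of_int (w i) - t0 * of_int (v i))\<bar> \<le> of_int (n i) * (if i = z then 1/5 else 1/6)"
      unfolding abs_mult using n(2)[OF i] eps[OF i] by (intro mult_mono) auto
  qed
  finally have nw: "doti n w = 0" using small by linarith
  have "doti n (\<lambda>j. if j = s then 1 else 0) = 1"
    using s by (simp add: doti_def if_distrib cong: if_cong)
  then obtain m0 where m0: "doti m0 v = 0" "doti m0 w = 0" "onto_pair n m0"
    using onto_pair_completion[OF np n(1) nw] by blast
  define m where "m i = 1 * m0 i + (- m0 s) * n i" for i
  have "onto_pair n m" unfolding m_def by (rule onto_pair_shear[OF m0(3)]) simp
  moreover have "doti m v = 0" "doti m w = 0" unfolding m_def doti_lincomb using m0 n nw by simp_all
  moreover have "m s = 0" by (simp add: m_def s)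
  moreover have "lonely v" if "covering n m h"
    by (rule lonely_if_covering[OF np \<open>onto_pair n m\<close> n(1) nw \<open>doti m v = 0\<close> \<open>doti m w = 0\<close> eps])
      (use that in \<open>simp_all add: h_def[abs_def]\<close>)
  ultimately show ?thesis by blast
qed

section \<open>Relations with two terms\<close>

text \<open>Here \<open>v i\<close>, \<open>v j\<close>, \<open>v k\<close> are multiples of a common speed. For \<open>\<bar>v i\<bar> \<ge> 4\<close> the lattice vector
  can be chosen to perturb only runner \<open>l\<close>, by at most \<open>2 / \<bar>v i\<bar>\<close>; otherwise \<open>v l\<close> is large, and the
  lattice vector is chosen to perturb only the other three runners.\<close>

lemma lonely_two_parallel:
  assumes e: "enum4 i j k l" and q: "q = 2 \<or> q = 3" and rel: "v j = - q * v i"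
    and m: "onto_pair (quad i j k q 1 0 0) m" "doti m v = 0" "m j = 0" "m l = 0"
    and mi: "\<bar>m i\<bar> \<le> 9" and mk: "\<bar>m k\<bar> = 2 \<and> q = 2 \<or> \<bar>m k\<bar> = 1 \<and> q < \<bar>m i\<bar>"
  shows "lonely v"
proof -
  define n where "n = quad i j k q 1 0 0"
  have n: "n i = q" "n j = 1" "n k = 0" "n l = 0"
    unfolding n_def by (simp_all add: quad_simps[OF e])
  have onto: "onto_pair n m" using m by (simp add: n_def)
  have nv: "doti n v = 0" unfolding doti_def enum4_sum[OF e] n using rel by simp
  have mv: "m i * v i + m k * v k = 0" using m(2-) unfolding doti_def enum4_sum[OF e] by simp
  have cov: "covering n m H"
    if H: "0 \<le> H i" "0 \<le> H j" "0 \<le> H k" "0 \<le> H l" and th: "\<theta> = of_int q * H i + H j - 1/2" "0 \<le> \<theta>" "\<theta> \<le> 2 * H j" "\<theta> \<le> 2 * of_int q * H i"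
      and D: "\<theta> * of_int \<bar>m i\<bar> / of_int q + 2 * H k * of_int \<bar>m k\<bar> \<ge> 1" for H \<theta>
    unfolding n_def using q D m by (intro covering_two_parallel[OF e _ H th]) auto
  show ?thesis
  proof (cases "4 \<le> \<bar>v i\<bar>")
    case True
    have vi: "v i \<noteq> 0" using True by auto
    \<comment> \<open>Runner \<open>l\<close> occurs in neither normal, so its half-side may shrink
      to 0; this tolerates its error of at most 2/4. The entry 1/15 keeps \<open>\<theta>\<close> at
      most \<open>2 * H j\<close>, with equality for \<open>q = 3\<close>.\<close>
    define E where "E = quad i j k (1/15) 0 0 (3/5 :: real)"
    have E: "E i = 1/15" "E j = 0" "E k = 0" "E l = 3/5" unfolding E_def by (simp_all add: quad_simps[OF e])
    have "covering n m (\<lambda>x. 3/10 - E x / 2)"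
      by (rule cov[OF _ _ _ _ refl]) (use q mk in \<open>auto simp: E\<close>)
    moreover have "\<bar>real_of_int (m k)\<bar> \<le> 2" using mk by auto
    moreover have "\<bar>real_of_int (v i)\<bar> \<ge> 4" using True by linarith
    ultimately show ?thesis
      by (intro lonely_if_covering_minors[OF e bez nv m(2) onto vi]) (auto simp: E n m)
  next
    case False
    have "\<bar>m k\<bar> * \<bar>v k\<bar> = \<bar>m i\<bar> * \<bar>v i\<bar>"
      using mv by (metis abs_minus_cancel abs_mult add_eq_0_iff)
    also have "\<dots> \<le> 9 * 3" using mi False by (intro mult_mono) auto
    finally have "\<bar>v k\<bar> \<le> 27" using mk by (auto split: if_splits)
    moreover have "\<bar>v j\<bar> \<le> 9" using rel q False by auto
    ultimately have vl: "\<bar>v l\<bar> \<ge> 157" using total False unfolding l1_def enum4_sum[OF e] by linarith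
    have e': "enum4 l i j k" using e unfolding enum4_def by auto
    \<comment> \<open>The other three speeds add up to at most 3 + 9 + 27, which leaves 157 for
      \<open>v l\<close>. The errors at \<open>i, j, k\<close> are at most 2, 4 and 9 over 157. For
      \<open>q = 3\<close> the entry at \<open>i\<close> is larger to keep \<open>\<theta>\<close>
      at most \<open>2 * H j\<close>.\<close>
    define E where "E = quad i j k (if q = 2 then 1/50 else 1/10) (1/25) (1/15) (0 :: real)"
    have E: "E i = (if q = 2 then 1/50 else 1/10)" "E j = 1/25" "E k = 1/15" "E l = 0"
      unfolding E_def by (simp_all add: quad_simps[OF e])
    have "covering n m (\<lambda>x. 3/10 - E x / 2)"
      by (rule cov[OF _ _ _ _ refl]) (use q mk in \<open>auto simp: E\<close>)
    moreover have "\<bar>real_of_int (m k)\<bar> \<le> 2" "\<bar>real_of_int (m i)\<bar> \<le> 9" using mk mi by auto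
    moreover have "\<bar>real_of_int (v l)\<bar> \<ge> 157" using vl by linarith
    moreover have "v l \<noteq> 0" using vl by auto
    ultimately show ?thesis
      using q by (intro lonely_if_covering_minors[OF e' bez nv m(2) onto]) (auto simp: E n m abs_mult)
  qed
qed

text \<open>A slice that is too short bounds the entries of \<open>m\<close>. Subtracting multiples
  of \<open>n\<close> turns most remaining \<open>m\<close> into relations excluded by
  \<open>no2\<close>, \<open>nob\<close> or \<open>no3\<close>; the others are supported on
  \<open>i\<close> and one further runner, as \<open>lonely_two_parallel\<close> requires.\<close>

lemma lonely_ratio_2_3:
  assumes e: "enum4 i j k l" and q: "q = 2 \<or> q = 3" and rel: "v j = - q * v i"
    and nob: "\<And>n. doti n v = 0 \<Longrightarrow> \<exists>x\<in>{1..4}. n x \<noteq> 0 \<Longrightarrow> \<forall>x\<in>{1..4}. \<bar>n x\<bar> \<le> 1 \<Longrightarrow> l1 n \<noteq> 3"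
    and no3: "\<And>n. q = 3 \<Longrightarrow> doti n v = 0 \<Longrightarrow> \<exists>x\<in>{1..4}. n x \<noteq> 0 \<Longrightarrow> 4 \<le> l1 n"
  shows "lonely v"
proof -
  define n where "n = quad i j k q 1 0 0"
  have n: "n i = q" "n j = 1" "n k = 0" "n l = 0"
    unfolding n_def by (simp_all add: quad_simps[OF e])
  have nv: "doti n v = 0" unfolding doti_def enum4_sum[OF e] n using rel by simp
  have "\<exists>m. doti m v = 0 \<and> onto_pair n m \<and> m j = 0 \<and> (covering n m h \<longrightarrow> lonely v)"
  proof (rule reduce)
    show "j \<in> {1..4}" using enum4_mem[OF e] by blast
    show "n j = 1" "doti n v = 0" by fact+
    show "n x \<ge> 0" for x using q by (auto simp: n_def quad_def)
    show "(\<Sum>x\<in>{1..4}. of_int (n x) * (if x = z then 1/5 else 1/6 :: real)) < 1"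
      unfolding enum4_sum[OF e] n using q e by (auto simp: enum4_def)
  qed
  then obtain m where m: "doti m v = 0" "onto_pair n m" "m j = 0" and cov: "covering n m h \<Longrightarrow> lonely v"
    by blast
  have mv: "m i * v i + m k * v k + m l * v l = 0"
    using m unfolding doti_def enum4_sum[OF e] by simp
  have pat: "\<bar>a\<bar> + \<bar>b\<bar> + \<bar>c\<bar> + \<bar>d\<bar> \<noteq> 3"
    if "a * v i + b * v j + c * v k + d * v l = 0" "\<bar>a\<bar> \<le> 1" "\<bar>b\<bar> \<le> 1" "\<bar>c\<bar> \<le> 1" "\<bar>d\<bar> \<le> 1" for a b c d
  proof (cases "a = 0 \<and> b = 0 \<and> c = 0 \<and> d = 0")
    case False
    have "doti (quad i j k a b c d) v = 0"
      unfolding doti_def enum4_sum[OF e] quad_simps[OF e] by (fact that)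
    moreover have "\<exists>x\<in>{1..4}. quad i j k a b c d x \<noteq> 0"
      using False quad_simps[OF e] enum4_mem[OF e] by metis
    moreover have "\<forall>x\<in>{1..4}. \<bar>quad i j k a b c d x\<bar> \<le> 1"
      using that unfolding enum4_ball[OF e] quad_simps[OF e] by simp
    ultimately have "l1 (quad i j k a b c d) \<noteq> 3" by (rule nob)
    then show ?thesis unfolding l1_def enum4_sum[OF e] quad_simps[OF e] .
  qed simp
  have sum3: "3 \<le> \<bar>a\<bar> + \<bar>b\<bar> + \<bar>c\<bar> + \<bar>d\<bar>" "q = 3 \<Longrightarrow> 4 \<le> \<bar>a\<bar> + \<bar>b\<bar> + \<bar>c\<bar> + \<bar>d\<bar>"
    if "a * v i + b * v j + c * v k + d * v l = 0" "a \<noteq> 0 \<or> b \<noteq> 0 \<or> c \<noteq> 0 \<or> d \<noteq> 0" for a b c d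
    using relation_wide[OF e that] no2 no3 by blast+
  have m0: "m i \<noteq> 0 \<or> m k \<noteq> 0 \<or> m l \<noteq> 0"
  proof (rule ccontr)
    assume "\<not> ?thesis"
    then have "\<forall>x\<in>{1..4}. 0 * n x + 1 * m x = 0" unfolding enum4_ball[OF e] using m by simp
    then show False using onto_pair_independent[OF m(2), of 0 1] by auto
  qed
  have main: "lonely v"
    if e': "enum4 i j k' l'" and kl: "m l' = 0" "m k' \<noteq> 0" "\<bar>m i\<bar> \<le> 9" "\<bar>m k'\<bar> = 2 \<and> q = 2 \<or> \<bar>m k'\<bar> = 1 \<and> q < \<bar>m i\<bar>"
      for k' l'
  proof -
    have "n = quad i j k' q 1 0 0" by (auto simp: n_def quad_def)
    then show ?thesis using lonely_two_parallel[OF e' q rel _ m(1,3) kl(1,3,4)] m(2) by simp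
  qed
  define X where "X = \<bar>m i\<bar>"
  define Y where "Y = \<bar>m k\<bar>"
  define Z where "Z = \<bar>m l\<bar>"
  define \<theta> where "\<theta> = of_int q * h i + h j - 1/2"
  have nn: "0 \<le> X" "0 \<le> Y" "0 \<le> Z" by (simp_all add: X_def Y_def Z_def)
  show ?thesis
  proof (cases "1 \<le> \<theta> * of_int X / of_int q + 2 * h k * of_int Y + 2 * h l * of_int Z")
    case True
    have "covering n m h"
      unfolding n_def
      by (rule covering_two_parallel[OF e _ _ _ _ _ \<theta>_def])
        (use h_cases[OF e] q m True in \<open>auto simp: \<theta>_def X_def Y_def Z_def\<close>)
    then show ?thesis by (rule cov)
  next
    case False
    have real: "0 \<le> real_of_int X" "0 \<le> real_of_int Y" "0 \<le> real_of_int Z" using nn by simp_all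
    have YZ: "Y + Z \<le> 2"
    proof (rule ccontr)
      assume "\<not> ?thesis"
      then have "real_of_int Y + of_int Z \<ge> 3" by linarith
      then show False using h_cases[OF e] q False real by (elim disjE) (auto simp: \<theta>_def)
    qed
    have X2: "X \<le> (if q = 2 then 2 else 1)" if "Y + Z = 2"
    proof (rule ccontr)
      assume "\<not> ?thesis"
      then have "real_of_int X \<ge> (if q = 2 then 3 else 2)" by (auto split: if_splits)
      moreover have "real_of_int Y + of_int Z = 2" using that by linarith
      ultimately show False using h_cases[OF e] q False real by (elim disjE) (auto simp: \<theta>_def)
    qed
    \<comment> \<open>The worst case is \<open>q = 2\<close> with \<open>z = i\<close>: there
      \<open>\<theta> / q = 7/120\<close>, and 10 * 7/120 + 13/30 = 61/60 whereas 9 would fall short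
      of 1.\<close>
    have X9: "X \<le> 9" if "Y + Z = 1"
    proof (rule ccontr)
      assume "\<not> ?thesis"
      then have "real_of_int X \<ge> 10" by linarith
      moreover have "real_of_int Y + of_int Z = 1" using that by linarith
      ultimately show False using h_cases[OF e] q False real by (elim disjE) (auto simp: \<theta>_def)
    qed
    have shift: "(m i - t * q) * v i + (- t) * v j + m k * v k + m l * v l = 0" for t
      using mv rel by (simp add: algebra_simps)
    have e2: "enum4 i j l k" using e by (auto simp: enum4_def)
    consider "Y + Z = 0" | "Y + Z = 1" | "Y = 1" "Z = 1" | "Y = 2" "Z = 0" | "Y = 0" "Z = 2"
      using YZ nn by linarith
    then show ?thesis
    proof cases
      case 1
      then have "m k = 0" "m l = 0" using nn by (auto simp: Y_def Z_def)
      then show ?thesis using m0 mv v_nonzero enum4_mem[OF e] by auto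
    next
      case 2
      have "q < X"
      proof (rule ccontr)
        assume nq: "\<not> q < X"
        have s: "m i = q \<or> m i = - q \<or> \<bar>m i\<bar> < q" using nq unfolding X_def by linarith
        show False
          using s sum3[OF shift, of 0] sum3[OF shift, of 1] sum3[OF shift, of "-1"] 2 q m0
          unfolding Y_def Z_def by auto
      qed
      then show ?thesis
        using main[OF e] main[OF e2] 2 X9[OF 2] nn unfolding X_def Y_def Z_def by fastforce
    next
      case 3
      then have X: "X \<le> (if q = 2 then 2 else 1)" using X2 by simp
      then have s: "m i = 0 \<or> m i = 1 \<or> m i = -1 \<or> q = 2 \<and> (m i = 2 \<or> m i = -2)"
        unfolding X_def by (auto split: if_splits)
      show ?thesis
        using s q 3 sum3[OF shift, of 0] pat[OF shift, of 0] pat[OF shift, of 1] pat[OF shift, of "-1"]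
        unfolding Y_def Z_def by auto
    next
      case 4
      show ?thesis
      proof (cases "q = 2")
        case True
        then show ?thesis using main[OF e] 4 X2 unfolding X_def Y_def Z_def by simp
      next
        case False
        have "m k \<noteq> 0" using 4 by (auto simp: Y_def)
        with False show ?thesis using X2 4 q sum3(2)[OF shift, of 0] unfolding X_def Y_def Z_def by auto
      qed
    next
      case 5
      show ?thesis
      proof (cases "q = 2")
        case True
        then show ?thesis using main[OF e2] 5 X2 unfolding X_def Y_def Z_def by simp
      next
        case False
        have "m l \<noteq> 0" using 5 by (auto simp: Z_def)
        with False show ?thesis using X2 5 q sum3(2)[OF shift, of 0] unfolding X_def Y_def Z_def by auto
      qed
    qed
  qed
qed

section \<open>Three speeds with sum zero\<close>

text \<open>Runner \<open>i\<close> is the fastest of the related three, so the total is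
  \<open>2 * \<bar>v i\<bar> + \<bar>v l\<bar>\<close>. A short slice bounds both \<open>m l\<close>
  and the spread \<open>R\<close> of \<open>m\<close> over the triple; the size of
  \<open>m l\<close> then decides whether \<open>v i\<close> or \<open>v l\<close> is large enough
  to divide by.\<close>

lemma lonely_sum_zero:
  assumes e: "enum4 i j k l" and rel: "v i + v j + v k = 0" and A: "\<bar>v i\<bar> = \<bar>v j\<bar> + \<bar>v k\<bar>"
  shows "lonely v"
proof -
  define n where "n = quad i j k 1 1 1 (0::int)"
  have n: "n i = 1" "n j = 1" "n k = 1" "n l = 0"
    unfolding n_def by (simp_all add: quad_simps[OF e])
  have nv: "doti n v = 0" unfolding doti_def enum4_sum[OF e] n using rel by simp
  have "\<exists>m. doti m v = 0 \<and> onto_pair n m \<and> m k = 0 \<and> (covering n m h \<longrightarrow> lonely v)"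
  proof (rule reduce)
    show "k \<in> {1..4}" using enum4_mem[OF e] by blast
    show "n k = 1" "doti n v = 0" by fact+
    show "n x \<ge> 0" for x by (auto simp: n_def quad_def)
    show "(\<Sum>x\<in>{1..4}. of_int (n x) * (if x = z then 1/5 else 1/6 :: real)) < 1"
      unfolding enum4_sum[OF e] n using e by (auto simp: enum4_def)
  qed
  then obtain m where m: "doti m v = 0" "onto_pair n m" "m k = 0" and cov: "covering n m h \<Longrightarrow> lonely v"
    by blast
  have mv: "m i * v i + m j * v j + m l * v l = 0"
    using m unfolding doti_def enum4_sum[OF e] by simp
  have m0: "m i \<noteq> 0 \<or> m j \<noteq> 0 \<or> m l \<noteq> 0"
  proof (rule ccontr)
    assume "\<not> ?thesis"
    then have "\<forall>x\<in>{1..4}. 0 * n x + 1 * m x = 0" unfolding enum4_ball[OF e] using m by simp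
    then show False using onto_pair_independent[OF m(2), of 0 1] by auto
  qed
  have sum3: "3 \<le> \<bar>m i - t\<bar> + \<bar>m j - t\<bar> + \<bar>t\<bar> + \<bar>m l\<bar>" if "t \<noteq> 0 \<or> m i \<noteq> 0 \<or> m j \<noteq> 0 \<or> m l \<noteq> 0" for t
  proof -
    have "(m i - t) * v i + (m j - t) * v j + (- t) * v k + m l * v l
        = (m i * v i + m j * v j + m l * v l) - t * (v i + v j + v k)"
      by (simp add: algebra_simps)
    then have "(m i - t) * v i + (m j - t) * v j + (- t) * v k + m l * v l = 0" using mv rel by simp
    from relation_wide[OF e this _ no2] show ?thesis using that by auto
  qed
  define R where "R = max \<bar>m i\<bar> (max \<bar>m j\<bar> \<bar>m i - m j\<bar>)"
  have R: "\<bar>m i\<bar> \<le> R" "\<bar>m j\<bar> \<le> R" "\<bar>m i - m j\<bar> \<le> R" "0 \<le> R" by (auto simp: R_def)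
  have corner: "covering n m H"
    if H: "0 \<le> H i" "0 \<le> H j" "0 \<le> H k" "0 \<le> H l"
      and th: "\<theta> = H i + H j + H k - 1/2" "0 \<le> \<theta>" "\<theta> \<le> 2 * H i" "\<theta> \<le> 2 * H j" "\<theta> \<le> 2 * H k"
      and D: "\<theta> * of_int R + 2 * H l * of_int \<bar>m l\<bar> \<ge> 1" for H \<theta>
  proof (rule covering_triple[OF e H n_def, of \<theta> m "of_int R"])
    show "real_of_int R \<le> max \<bar>real_of_int (m i) / real_of_int 1\<bar>
        (max (real_of_int \<bar>m j\<bar>) \<bar>real_of_int (m i) / real_of_int 1 - real_of_int (m j)\<bar>)"
      unfolding R_def by (simp add: of_int_max)
  qed (use th D m in auto)
  have big: "2 * \<bar>v i\<bar> + \<bar>v l\<bar> \<ge> 196" using total A unfolding l1_def enum4_sum[OF e] by linarith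
  \<comment> \<open>After eliminating \<open>v i\<close>, the coefficients of \<open>v j\<close> and
    \<open>v k\<close> are differences of entries of \<open>m\<close> within the triple, hence at
    most \<open>R\<close>.\<close>
  have vl: "\<bar>m l\<bar> * \<bar>v l\<bar> \<le> R * \<bar>v i\<bar>"
  proof -
    have "m l * v l = (m i - m j) * v j + m i * v k"
    proof -
      have vi: "v i = - v j - v k" using rel by simp
      show ?thesis using mv unfolding vi by (simp add: algebra_simps)
    qed
    then have "\<bar>m l\<bar> * \<bar>v l\<bar> \<le> \<bar>m i - m j\<bar> * \<bar>v j\<bar> + \<bar>m i\<bar> * \<bar>v k\<bar>"
      by (metis abs_mult abs_triangle_ineq)
    also have "\<dots> \<le> R * \<bar>v j\<bar> + R * \<bar>v k\<bar>" using R by (intro add_mono mult_right_mono) auto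
    finally show ?thesis unfolding A by (simp add: algebra_simps)
  qed
  have e': "enum4 l i j k" using e by (auto simp: enum4_def)
  have vnz: "v i \<noteq> 0" "v l \<noteq> 0" using v_nonzero enum4_mem[OF e] by blast+
  define \<theta> where "\<theta> = h i + h j + h k - 1/2"
  show ?thesis
  proof (cases "1 \<le> \<theta> * of_int R + 2 * h l * of_int \<bar>m l\<bar>")
    case True
    have "covering n m h"
      by (rule corner[OF _ _ _ _ \<theta>_def]) (use h_cases[OF e] True in \<open>auto simp: \<theta>_def\<close>)
    then show ?thesis by (rule cov)
  next
    case False
    have Rr: "0 \<le> real_of_int R" using R by simp
    have ml: "\<bar>m l\<bar> \<le> 2"
    proof (rule ccontr)
      assume "\<not> ?thesis"
      then have "real_of_int \<bar>m l\<bar> \<ge> 3" by linarith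
      then show False using h_cases[OF e] False Rr by (elim disjE) (auto simp: \<theta>_def)
    qed
    have R2: "R \<le> 1" if "\<bar>m l\<bar> = 2"
    proof (rule ccontr)
      assume "\<not> ?thesis"
      then have "real_of_int R \<ge> 2" by linarith
      moreover have "real_of_int \<bar>m l\<bar> = 2" using that by linarith
      ultimately show False using h_cases[OF e] False by (elim disjE) (auto simp: \<theta>_def)
    qed
    have R1: "R \<le> 4" if "\<bar>m l\<bar> = 1"
    proof (rule ccontr)
      assume "\<not> ?thesis"
      then have "real_of_int R \<ge> 5" by linarith
      moreover have "real_of_int \<bar>m l\<bar> = 1" using that by linarith
      ultimately show False using h_cases[OF e] False by (elim disjE) (auto simp: \<theta>_def)
    qed
    \<comment> \<open>Here \<open>\<theta>\<close> is at least 2/15, so 8 is the first spread that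
      suffices without help from \<open>m l\<close>.\<close>
    have R0: "R \<le> 7" if "m l = 0"
    proof (rule ccontr)
      assume "\<not> ?thesis"
      then have "real_of_int R \<ge> 8" by linarith
      then show False using h_cases[OF e] False that by (elim disjE) (auto simp: \<theta>_def)
    qed
    consider "m l = 0" | "\<bar>m l\<bar> = 1" | "\<bar>m l\<bar> = 2" using ml by linarith
    then show ?thesis
    proof cases
      case 1
      \<comment> \<open>With a smaller spread some \<open>m - t n\<close> would be a relation of
        norm below 3.\<close>
      have "R \<ge> 3"
      proof (rule ccontr)
        assume "\<not> ?thesis"
        then have "\<bar>m i\<bar> \<le> 2" "\<bar>m j\<bar> \<le> 2" "\<bar>m i - m j\<bar> \<le> 2" using R by linarith+
        then have "m i \<in> {-2, -1, 0, 1, 2}" "m j \<in> {-2, -1, 0, 1, 2}" "\<bar>m i - m j\<bar> \<le> 2" by auto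
        then show False
          using sum3[of 0] sum3[of 1] sum3[of "-1"] sum3[of 2] sum3[of "-2"] m0 1 by auto
      qed
      then have R3: "real_of_int R \<ge> 3" by linarith
      have R7: "real_of_int R \<le> 7" using R0 1 by simp
      have Rm: "\<bar>real_of_int (m i)\<bar> \<le> 7" "\<bar>real_of_int (m j)\<bar> \<le> 7" "\<bar>real_of_int (m i) - of_int (m j)\<bar> \<le> 7"
        using R R0 1 by linarith+
      show ?thesis
      proof (cases "\<bar>v i\<bar> \<ge> 12")
        case True
        \<comment> \<open>The whole error, at most 7/12, falls on runner \<open>l\<close>, which
          occurs in neither normal.\<close>
        define E where "E = quad i j k 0 0 0 (3/5 :: real)"
        have E: "E i = 0" "E j = 0" "E k = 0" "E l = 3/5" unfolding E_def by (simp_all add: quad_simps[OF e])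
        have "covering n m (\<lambda>x. 3/10 - E x / 2)"
          by (rule corner[OF _ _ _ _ refl]) (use R3 in \<open>auto simp: E\<close>)
        moreover have "\<bar>real_of_int (v i)\<bar> \<ge> 12" using True by linarith
        ultimately show ?thesis
          using Rm by (intro lonely_if_covering_minors[OF e bez nv m(1,2) vnz(1)]) (auto simp: E n m 1)
      next
        case False
        then have "\<bar>real_of_int (v l)\<bar> \<ge> 174" using big by linarith
        \<comment> \<open>The errors are at most 7/174, below 1/24, and then
          \<open>3 * \<theta>\<close> is still 81/80.\<close>
        define E where "E = quad i j k (1/24) (1/24) (1/24) (0 :: real)"
        have E: "E i = 1/24" "E j = 1/24" "E k = 1/24" "E l = 0" unfolding E_def by (simp_all add: quad_simps[OF e])
        have "covering n m (\<lambda>x. 3/10 - E x / 2)"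
          by (rule corner[OF _ _ _ _ refl]) (use R3 in \<open>auto simp: E\<close>)
        then show ?thesis
          using Rm \<open>\<bar>real_of_int (v l)\<bar> \<ge> 174\<close>
          by (intro lonely_if_covering_minors[OF e' bez nv m(1,2) vnz(2)]) (auto simp: E n m abs_minus_commute)
      qed
    next
      case 2
      have R4: "R \<le> 4" using R1 2 by simp
      have "R \<ge> 2"
      proof (rule ccontr)
        assume "\<not> ?thesis"
        then have "\<bar>m i\<bar> \<le> 1" "\<bar>m j\<bar> \<le> 1" "\<bar>m i - m j\<bar> \<le> 1" using R by linarith+
        then have "m i \<in> {-1, 0, 1}" "m j \<in> {-1, 0, 1}" "\<bar>m i - m j\<bar> \<le> 1" "m l \<in> {-1, 1}" using 2 by auto
        then show False
          using sum3[of 0] sum3[of 1] sum3[of "-1"] by auto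
      qed
      then have R2: "real_of_int R \<ge> 2" by linarith
      have "R * \<bar>v i\<bar> \<le> 4 * \<bar>v i\<bar>" using R4 by (intro mult_right_mono) auto
      \<comment> \<open>Here \<open>\<bar>v l\<bar>\<close> is at most
        \<open>4 * \<bar>v i\<bar>\<close>, so six times \<open>\<bar>v i\<bar>\<close> is at least
        196.\<close>
      then have A33: "\<bar>real_of_int (v i)\<bar> \<ge> 32" using vl big 2 by simp
      have Rm: "\<bar>real_of_int (m i)\<bar> \<le> 4" "\<bar>real_of_int (m j)\<bar> \<le> 4" using R R4 by linarith+
      have mr: "\<bar>real_of_int (m l)\<bar> = 1" using 2 by linarith
      define E where "E = quad i j k 0 (1/32) (1/32) (1/8 :: real)"
      have E: "E i = 0" "E j = 1/32" "E k = 1/32" "E l = 1/8" unfolding E_def by (simp_all add: quad_simps[OF e])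
      have "covering n m (\<lambda>x. 3/10 - E x / 2)"
        by (rule corner[OF _ _ _ _ refl]) (use R2 2 in \<open>auto simp: E\<close>)
      then show ?thesis
        using Rm A33 mr by (intro lonely_if_covering_minors[OF e bez nv m(1,2) vnz(1)]) (auto simp: E n m)
    next
      case 3
      have R1: "R \<le> 1" using R2 3 by simp
      have "R * \<bar>v i\<bar> \<le> 1 * \<bar>v i\<bar>" using R1 by (intro mult_right_mono) auto
      \<comment> \<open>Now \<open>v l\<close> is at most half of \<open>v i\<close> in absolute
        value, so 5/2 of \<open>\<bar>v i\<bar>\<close> is at least 196.\<close>
      then have A78: "\<bar>real_of_int (v i)\<bar> \<ge> 78" using vl big 3 by simp
      have Rm: "\<bar>real_of_int (m i)\<bar> \<le> 1" "\<bar>real_of_int (m j)\<bar> \<le> 1" using R R1 by linarith+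
      have mr: "\<bar>real_of_int (m l)\<bar> = 2" using 3 by linarith
      define E where "E = quad i j k 0 (1/39) (1/39) (1/78 :: real)"
      have E: "E i = 0" "E j = 1/39" "E k = 1/39" "E l = 1/78" unfolding E_def by (simp_all add: quad_simps[OF e])
      have "covering n m (\<lambda>x. 3/10 - E x / 2)"
        by (rule corner[OF _ _ _ _ refl]) (use Rr 3 in \<open>auto simp: E\<close>)
      then show ?thesis
        using Rm A78 mr by (intro lonely_if_covering_minors[OF e bez nv m(1,2) vnz(1)]) (auto simp: E n m)
    qed
  qed
qed

section \<open>Relations of norm four with three or four terms\<close>

lemma relation_quad:
  assumes e: "enum4 i j k l" and rel: "a * v i + b * v j + c * v k + d * v l = 0"
    and nz: "a \<noteq> 0 \<or> b \<noteq> 0 \<or> c \<noteq> 0 \<or> d \<noteq> 0"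
  shows "doti (quad i j k a b c d) v = 0" "\<exists>x\<in>{1..4}. quad i j k a b c d x \<noteq> 0"
    "l1 (quad i j k a b c d) = \<bar>a\<bar> + \<bar>b\<bar> + \<bar>c\<bar> + \<bar>d\<bar>"
    "(\<forall>x\<in>{1..4}. \<bar>quad i j k a b c d x\<bar> \<le> N) \<longleftrightarrow> \<bar>a\<bar> \<le> N \<and> \<bar>b\<bar> \<le> N \<and> \<bar>c\<bar> \<le> N \<and> \<bar>d\<bar> \<le> N"
proof -
  show "doti (quad i j k a b c d) v = 0"
    unfolding doti_def enum4_sum[OF e] quad_simps[OF e] by (fact rel)
  show "\<exists>x\<in>{1..4}. quad i j k a b c d x \<noteq> 0"
    using nz quad_simps[OF e] enum4_mem[OF e] by metis
  show "l1 (quad i j k a b c d) = \<bar>a\<bar> + \<bar>b\<bar> + \<bar>c\<bar> + \<bar>d\<bar>"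
    unfolding l1_def enum4_sum[OF e] quad_simps[OF e] ..
  show "(\<forall>x\<in>{1..4}. \<bar>quad i j k a b c d x\<bar> \<le> N) \<longleftrightarrow> \<bar>a\<bar> \<le> N \<and> \<bar>b\<bar> \<le> N \<and> \<bar>c\<bar> \<le> N \<and> \<bar>d\<bar> \<le> N"
    unfolding enum4_ball[OF e] quad_simps[OF e] ..
qed

text \<open>The sums are the norms of \<open>m - t (1,1,1,1)\<close> for small \<open>t\<close>,
  where \<open>m\<close> has entries \<open>a, b, c\<close> and 0; the summands 1 and 2 come from
  that last entry. A check of 125 triples leaves twice the indicator vectors of pairs.\<close>

lemma even_pair_if_no_short_shift:
  fixes a b c :: int
  assumes b: "\<bar>a\<bar> \<le> 2" "\<bar>b\<bar> \<le> 2" "\<bar>c\<bar> \<le> 2" "\<bar>a - b\<bar> \<le> 2" "\<bar>a - c\<bar> \<le> 2" "\<bar>b - c\<bar> \<le> 2"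
    and S: "4 \<le> \<bar>a\<bar> + \<bar>b\<bar> + \<bar>c\<bar>" "4 \<le> \<bar>a - 1\<bar> + \<bar>b - 1\<bar> + 1 + \<bar>c - 1\<bar>"
        "4 \<le> \<bar>a + 1\<bar> + \<bar>b + 1\<bar> + 1 + \<bar>c + 1\<bar>"
        "4 \<le> \<bar>a - 2\<bar> + \<bar>b - 2\<bar> + 2 + \<bar>c - 2\<bar>" "4 \<le> \<bar>a + 2\<bar> + \<bar>b + 2\<bar> + 2 + \<bar>c + 2\<bar>"
  shows "\<exists>t\<in>{-1, 1}. (a, b, c) \<in> {(2 * t, 2 * t, 0), (2 * t, 0, 2 * t), (0, 2 * t, 2 * t)}"
proof -
  have mem: "x \<in> {-2, -1, 0, 1, 2}" if "\<bar>x\<bar> \<le> 2" for x :: int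
    using that by auto
  have "\<forall>a\<in>{-2, -1, 0, 1, 2::int}. \<forall>b\<in>{-2, -1, 0, 1, 2::int}. \<forall>c\<in>{-2, -1, 0, 1, 2::int}.
    \<bar>a - b\<bar> \<le> 2 \<and> \<bar>a - c\<bar> \<le> 2 \<and> \<bar>b - c\<bar> \<le> 2 \<and> 4 \<le> \<bar>a\<bar> + \<bar>b\<bar> + \<bar>c\<bar> \<and> 4 \<le> \<bar>a - 1\<bar> + \<bar>b - 1\<bar> + 1 + \<bar>c - 1\<bar> \<and>
    4 \<le> \<bar>a + 1\<bar> + \<bar>b + 1\<bar> + 1 + \<bar>c + 1\<bar> \<and> 4 \<le> \<bar>a - 2\<bar> + \<bar>b - 2\<bar> + 2 + \<bar>c - 2\<bar> \<and>
    4 \<le> \<bar>a + 2\<bar> + \<bar>b + 2\<bar> + 2 + \<bar>c + 2\<bar> \<longrightarrow>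
    (\<exists>t\<in>{-1, 1}. (a, b, c) \<in> {(2 * t, 2 * t, 0), (2 * t, 0, 2 * t), (0, 2 * t, 2 * t)})"
    by simp
  from this[rule_format, OF mem[OF b(1)] mem[OF b(2)] mem[OF b(3)]] show ?thesis
    using b(4-6) S by blast
qed

text \<open>Since \<open>\<theta> = 7/20\<close>, two entries of \<open>m\<close> that differ by 3
  make the slices long enough. Otherwise \<open>m\<close> is twice a pair, so two speeds cancel,
  contradicting the absence of relations of norm 2.\<close>

lemma lonely_four_sum_zero:
  assumes e: "enum4 i j k l" and rel: "v i + v j + v k + v l = 0"
    and no3: "\<And>n. doti n v = 0 \<Longrightarrow> \<exists>x\<in>{1..4}. n x \<noteq> 0 \<Longrightarrow> 4 \<le> l1 n"
  shows "lonely v"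
proof -
  define n :: "nat \<Rightarrow> int" where "n = (\<lambda>_. 1)"
  have nv: "doti n v = 0" unfolding doti_def enum4_sum[OF e] n_def using rel by simp
  have "\<exists>m. doti m v = 0 \<and> onto_pair n m \<and> m k = 0 \<and> (covering n m h \<longrightarrow> lonely v)"
  proof (rule reduce)
    show "k \<in> {1..4}" using enum4_mem[OF e] by blast
    show "doti n v = 0" by fact
    show "n k = 1" "n x \<ge> 0" for x by (auto simp: n_def)
    show "(\<Sum>x\<in>{1..4}. of_int (n x) * (if x = z then 1/5 else 1/6 :: real)) < 1"
      unfolding enum4_sum[OF e] n_def using e by (auto simp: enum4_def)
  qed
  then obtain m where m: "doti m v = 0" "onto_pair n m" "m k = 0" and cov: "covering n m h \<Longrightarrow> lonely v"
    by blast
  have mv: "m i * v i + m j * v j + m l * v l = 0"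
    using m unfolding doti_def enum4_sum[OF e] by simp
  have m0: "m i \<noteq> 0 \<or> m j \<noteq> 0 \<or> m l \<noteq> 0"
  proof (rule ccontr)
    assume "\<not> ?thesis"
    then have "\<forall>x\<in>{1..4}. 0 * n x + 1 * m x = 0" unfolding enum4_ball[OF e] using m by simp
    then show False using onto_pair_independent[OF m(2), of 0 1] by auto
  qed
  have sum4: "4 \<le> \<bar>m i - t\<bar> + \<bar>m j - t\<bar> + \<bar>t\<bar> + \<bar>m l - t\<bar>" if "t \<noteq> 0 \<or> m i \<noteq> 0 \<or> m j \<noteq> 0 \<or> m l \<noteq> 0" for t
  proof -
    have "(m i - t) * v i + (m j - t) * v j + (- t) * v k + (m l - t) * v l
        = (m i * v i + m j * v j + m l * v l) - t * (v i + v j + v k + v l)"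
      by (simp add: algebra_simps)
    then have "(m i - t) * v i + (m j - t) * v j + (- t) * v k + (m l - t) * v l = 0" using mv rel by simp
    from relation_wide[OF e this _ no3] show ?thesis using that by auto
  qed
  have ne: "v i + v j \<noteq> 0" "v i + v l \<noteq> 0" "v j + v l \<noteq> 0"
    using relation_wide[OF e, of 1 1 0 0 4] relation_wide[OF e, of 1 0 0 1 4] relation_wide[OF e, of 0 1 0 1 4] no3
    by auto
  have small: "\<bar>m a\<bar> \<le> 2 \<and> \<bar>m b\<bar> \<le> 2 \<and> \<bar>m a - m b\<bar> \<le> 2"
    if nl: "\<not> covering n m h" and e': "enum4 a b k d" for a b d
  proof (rule ccontr)
    assume "\<not> ?thesis"
    then have "max \<bar>m a\<bar> (max \<bar>m b\<bar> \<bar>m a - m b\<bar>) \<ge> 3" by auto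
    then have "real_of_int 3 \<le> real_of_int (max \<bar>m a\<bar> (max \<bar>m b\<bar> \<bar>m a - m b\<bar>))" unfolding of_int_le_iff .
    then have r: "3 \<le> max \<bar>real_of_int (m a) / of_int 1\<bar> (max (of_int \<bar>m b\<bar>) \<bar>of_int (m a) / of_int 1 - real_of_int (m b)\<bar>)"
      by (simp add: of_int_max)
    have "covering n m h"
    proof (rule covering_triple[OF e' _ _ _ _ _ _ _ refl _ _ _ _ m(3) r])
      show "n = quad a b k 1 1 1 1" by (auto simp: n_def quad_def)
    qed (use h_cases[OF e'] in auto)
    then show False using nl by blast
  qed
  show ?thesis
  proof (rule ccontr)
    assume "\<not> ?thesis"
    then have nl: "\<not> covering n m h" using cov by blast
    have "enum4 i j k l" "enum4 i l k j" "enum4 j l k i" using e by (auto simp: enum4_def)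
    then have b: "\<bar>m i\<bar> \<le> 2" "\<bar>m j\<bar> \<le> 2" "\<bar>m l\<bar> \<le> 2" "\<bar>m i - m j\<bar> \<le> 2" "\<bar>m i - m l\<bar> \<le> 2" "\<bar>m j - m l\<bar> \<le> 2"
      using small[OF nl] by blast+
    have even: "\<not> (m i = 2 * t \<and> m j = 2 * t \<and> m l = 0)" "\<not> (m i = 2 * t \<and> m j = 0 \<and> m l = 2 * t)"
      "\<not> (m i = 0 \<and> m j = 2 * t \<and> m l = 2 * t)" if "t \<noteq> 0" for t
    proof -
      have "2 * t * (v i + v j) \<noteq> 0" "2 * t * (v i + v l) \<noteq> 0" "2 * t * (v j + v l) \<noteq> 0"
        using that ne by simp_all
      then show "\<not> (m i = 2 * t \<and> m j = 2 * t \<and> m l = 0)" "\<not> (m i = 2 * t \<and> m j = 0 \<and> m l = 2 * t)"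
        "\<not> (m i = 0 \<and> m j = 2 * t \<and> m l = 2 * t)"
        using mv by (auto simp: algebra_simps)
    qed
    have S: "4 \<le> \<bar>m i\<bar> + \<bar>m j\<bar> + \<bar>m l\<bar>" using sum4[of 0] m0 by simp
    have S1: "4 \<le> \<bar>m i - 1\<bar> + \<bar>m j - 1\<bar> + 1 + \<bar>m l - 1\<bar>" using sum4[of 1] by simp
    have S2: "4 \<le> \<bar>m i + 1\<bar> + \<bar>m j + 1\<bar> + 1 + \<bar>m l + 1\<bar>" using sum4[of "-1"] by simp
    have S3: "4 \<le> \<bar>m i - 2\<bar> + \<bar>m j - 2\<bar> + 2 + \<bar>m l - 2\<bar>" using sum4[of 2] by simp
    have S4: "4 \<le> \<bar>m i + 2\<bar> + \<bar>m j + 2\<bar> + 2 + \<bar>m l + 2\<bar>" using sum4[of "-2"] by simp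
    show False using even_pair_if_no_short_shift[OF b S S1 S2 S3 S4] even[of 1] even[of "-1"] by auto
  qed
qed

text \<open>A short slice leaves finitely many \<open>m\<close>. For almost all of them some
  \<open>m - t n\<close> has norm below 4, or has norm 4 and one of the two shapes excluded by
  \<open>no1\<close> and \<open>noc\<close>.\<close>

lemma lonely_double_sum_zero:
  assumes e: "enum4 i j k l" and rel: "2 * v i + v j + v k = 0"
    and no3: "\<And>n. doti n v = 0 \<Longrightarrow> \<exists>x\<in>{1..4}. n x \<noteq> 0 \<Longrightarrow> 4 \<le> l1 n"
    and no1: "\<And>n. doti n v = 0 \<Longrightarrow> \<exists>x\<in>{1..4}. n x \<noteq> 0 \<Longrightarrow> \<forall>x\<in>{1..4}. \<bar>n x\<bar> \<le> 1 \<Longrightarrow> l1 n \<noteq> 4"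
    and noc: "\<And>n. doti n v = 0 \<Longrightarrow> \<exists>x\<in>{1..4}. n x \<noteq> 0 \<Longrightarrow> l1 n = 4 \<Longrightarrow> \<forall>x\<in>{1..4}. \<bar>n x\<bar> \<le> 2"
  shows "lonely v"
proof (rule ccontr)
  assume not_lonely: "\<not> ?thesis"
  define n where "n = quad i j k 2 1 1 (0::int)"
  have n: "n i = 2" "n j = 1" "n k = 1" "n l = 0"
    unfolding n_def by (simp_all add: quad_simps[OF e])
  have nv: "doti n v = 0" unfolding doti_def enum4_sum[OF e] n using rel by simp
  have "\<exists>m. doti m v = 0 \<and> onto_pair n m \<and> m k = 0 \<and> (covering n m h \<longrightarrow> lonely v)"
  proof (rule reduce)
    show "k \<in> {1..4}" using enum4_mem[OF e] by blast
    show "n k = 1" "doti n v = 0" by fact+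
    show "n x \<ge> 0" for x by (auto simp: n_def quad_def)
    show "(\<Sum>x\<in>{1..4}. of_int (n x) * (if x = z then 1/5 else 1/6 :: real)) < 1"
      unfolding enum4_sum[OF e] n using e by (auto simp: enum4_def)
  qed
  then obtain m where m: "doti m v = 0" "onto_pair n m" "m k = 0" and cov: "covering n m h \<Longrightarrow> lonely v"
    by blast
  have mv: "m i * v i + m j * v j + m l * v l = 0"
    using m unfolding doti_def enum4_sum[OF e] by simp
  have m0: "m i \<noteq> 0 \<or> m j \<noteq> 0 \<or> m l \<noteq> 0"
  proof (rule ccontr)
    assume "\<not> ?thesis"
    then have "\<forall>x\<in>{1..4}. 0 * n x + 1 * m x = 0" unfolding enum4_ball[OF e] using m by simp
    then show False using onto_pair_independent[OF m(2), of 0 1] by auto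
  qed
  define S where "S t = \<bar>m i - 2 * t\<bar> + \<bar>m j - t\<bar> + \<bar>t\<bar> + \<bar>m l\<bar>" for t
  have shift: "4 \<le> S t \<and> (S t = 4 \<longrightarrow> \<not> (\<bar>m i - 2 * t\<bar> \<le> 1 \<and> \<bar>m j - t\<bar> \<le> 1 \<and> \<bar>t\<bar> \<le> 1 \<and> \<bar>m l\<bar> \<le> 1) \<and>
      \<bar>m i - 2 * t\<bar> \<le> 2 \<and> \<bar>m j - t\<bar> \<le> 2 \<and> \<bar>t\<bar> \<le> 2 \<and> \<bar>m l\<bar> \<le> 2)" for t
  proof -
    have "(m i - 2 * t) * v i + (m j - t) * v j + (- t) * v k + m l * v l
        = (m i * v i + m j * v j + m l * v l) - t * (2 * v i + v j + v k)"
      by (simp add: algebra_simps)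
    then have r: "(m i - 2 * t) * v i + (m j - t) * v j + (- t) * v k + m l * v l = 0" using mv rel by simp
    have nz: "m i - 2 * t \<noteq> 0 \<or> m j - t \<noteq> 0 \<or> - t \<noteq> 0 \<or> m l \<noteq> 0" using m0 by auto
    note Q = relation_quad[OF e r nz]
    show ?thesis
      using no3[OF Q(1,2)] no1[OF Q(1,2)] noc[OF Q(1,2)] unfolding Q(3,4) S_def by auto
  qed
  define R where "R = max \<bar>real_of_int (m i) / of_int 2\<bar> (max (of_int \<bar>m j\<bar>) \<bar>of_int (m i) / of_int 2 - real_of_int (m j)\<bar>)"
  have "\<bar>real_of_int (m i) / 2\<bar> \<le> R" "\<bar>real_of_int (m i) / 2 - of_int (m j)\<bar> \<le> R" and Rj: "\<bar>real_of_int (m j)\<bar> \<le> R"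
    by (simp_all add: R_def)
  then have R: "\<bar>real_of_int (m i)\<bar> \<le> 2 * R" "\<bar>real_of_int (m j)\<bar> \<le> R"
      "\<bar>real_of_int (m i) - 2 * of_int (m j)\<bar> \<le> 2 * R" "0 \<le> R"
    by linarith+
  define \<theta> where "\<theta> = 2 * h i + h j + h k - 1/2"
  have lt: "\<theta> * R + 2 * h l * of_int \<bar>m l\<bar> < 1"
  proof (rule ccontr)
    assume nlt: "\<not> ?thesis"
    have "covering n m h"
      by (rule covering_triple[OF e _ _ _ _ n_def, of h \<theta> m R])
        (use h_cases[OF e] nlt m(3) in \<open>auto simp: \<theta>_def R_def\<close>)
    then show False using cov not_lonely by blast
  qed
  have ml: "\<bar>m l\<bar> \<le> 2"
  proof (rule ccontr)
    assume "\<not> ?thesis"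
    then have "real_of_int \<bar>m l\<bar> \<ge> 3" by linarith
    then show False using h_cases[OF e] lt R(4) by (elim disjE) (auto simp: \<theta>_def)
  qed
  have R0: "R < 3" using h_cases[OF e] lt by (elim disjE) (auto simp: \<theta>_def)
  have R1: "R < 17/10" if "\<bar>m l\<bar> = 1"
  proof -
    have "real_of_int \<bar>m l\<bar> = 1" using that by linarith
    then show ?thesis using h_cases[OF e] lt by (elim disjE) (auto simp: \<theta>_def)
  qed
  have R2: "R < 6/10" if "\<bar>m l\<bar> = 2"
  proof -
    have "real_of_int \<bar>m l\<bar> = 2" using that by linarith
    then show ?thesis using h_cases[OF e] lt by (elim disjE) (auto simp: \<theta>_def)
  qed
  note sh = shift[of 0] shift[of 1] shift[of "-1"] shift[of 2] shift[of "-2"]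
  have vi: "v i \<noteq> 0" using v_nonzero enum4_mem[OF e] by blast
  consider "m l = 0" | "\<bar>m l\<bar> = 1" | "\<bar>m l\<bar> = 2" using ml by linarith
  then show False
  proof cases
    case 1
    have b: "- 5 \<le> m i" "m i \<le> 5" "- 2 \<le> m j" "m j \<le> 2" "\<bar>m i - 2 * m j\<bar> \<le> 5"
      using R R0 by linarith+
    have "m i \<in> {-5, -4, -3, -2, -1, 0, 1, 2, 3, 4, 5}" using b(1,2) unfolding insert_iff empty_iff by presburger
    moreover have "m j \<in> {-2, -1, 0, 1, 2}" using b(3,4) unfolding insert_iff empty_iff by presburger
    \<comment> \<open>The vectors \<open>m\<close> with entry 5 or -5 at \<open>i\<close> and 0
      elsewhere pass all shift tests; they are excluded by \<open>mv\<close> and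
      \<open>vi\<close>.\<close>
    ultimately show False
      by (elim insertE emptyE; insert sh mv vi 1 b(5); simp add: S_def)
  next
    case 2
    have b: "- 3 \<le> m i" "m i \<le> 3" "- 1 \<le> m j" "m j \<le> 1" "\<bar>m i - 2 * m j\<bar> \<le> 3"
      using R R1[OF 2] by linarith+
    have "m i \<in> {-3, -2, -1, 0, 1, 2, 3}" using b(1,2) unfolding insert_iff empty_iff by presburger
    moreover have "m j \<in> {-1, 0, 1}" using b(3,4) unfolding insert_iff empty_iff by presburger
    moreover have "m l \<in> {-1, 1}" using 2 unfolding insert_iff empty_iff by linarith
    ultimately show False
      by (elim insertE emptyE; insert sh b(5); simp add: S_def)
  next
    case 3
    have b: "- 1 \<le> m i" "m i \<le> 1" "m j = 0" using R R2[OF 3] by linarith+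
    have "m i \<in> {-1, 0, 1}" using b(1,2) unfolding insert_iff empty_iff by presburger
    moreover have "m l \<in> {-2, 2}" using 3 unfolding insert_iff empty_iff by linarith
    ultimately show False
      by (elim insertE emptyE; insert sh b(3); simp add: S_def)
  qed
qed

end

subsection \<open>Classification of short relations\<close>

lemma dist_nearest_int_minus: "dist_nearest_int (- x) = dist_nearest_int x"
proof -
  have le: "dist_nearest_int (- y) \<le> dist_nearest_int y" for y
    using dist_nearest_int_le[of "- y" "- round y"] unfolding dist_nearest_int_def[of y] by simp
  show ?thesis using le[of x] le[of "- x"] by simp
qed

text \<open>Distance to the nearest integer is even, so a change of sign of a speed can be absorbed
  into its starting point.\<close>

lemma lonely_sign:
  assumes s: "\<And>i. s i = 1 \<or> s i = -1" and l: "lonely (\<lambda>i. s i * v i)"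
  shows "lonely v"
  unfolding lonely_def
proof
  fix \<sigma> :: "nat \<Rightarrow> real"
  obtain t where t: "\<forall>i\<in>{1..4}. dist_nearest_int (of_int (s i * v i) * t + of_int (s i) * \<sigma> i) \<ge> 1/5"
    using l unfolding lonely_def by meson
  have "dist_nearest_int (of_int (s i * v i) * t + of_int (s i) * \<sigma> i) = dist_nearest_int (of_int (v i) * t + \<sigma> i)" for i
    using s[of i] dist_nearest_int_minus[of "of_int (v i) * t + \<sigma> i"] by auto
  then show "\<exists>t. \<forall>i\<in>{1..4}. dist_nearest_int (of_int (v i) * t + \<sigma> i) \<ge> 1/5" using t by auto
qed

lemma doti_sign: "doti n (\<lambda>i. s i * v i) = doti (\<lambda>i. s i * n i) v"
  by (simp add: doti_def algebra_simps)

text \<open>A normal form for matching relations against the list of types: decreasing absolute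
  coefficients, with their signs moved into the speeds.\<close>

lemma sorted_relation:
  assumes "doti n v = 0"
  shows "\<exists>i j k l s. enum4 i j k l \<and> (\<forall>x. s x = 1 \<or> s x = (-1::int)) \<and>
    \<bar>n i\<bar> * (s i * v i) + \<bar>n j\<bar> * (s j * v j) + \<bar>n k\<bar> * (s k * v k) + \<bar>n l\<bar> * (s l * v l) = 0 \<and>
    \<bar>n j\<bar> \<le> \<bar>n i\<bar> \<and> \<bar>n k\<bar> \<le> \<bar>n j\<bar> \<and> \<bar>n l\<bar> \<le> \<bar>n k\<bar>"
proof -
  define ys :: "nat list" where "ys = [1, 2, 3, 4]"
  have ys: "length ys = 4" "set ys = {1..4}" "distinct ys" by (auto simp: ys_def)
  define xs where "xs = sort_key (\<lambda>i. - \<bar>n i\<bar>) ys"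
  have "length xs = 4" by (simp add: xs_def ys)
  then obtain i j k l where xs: "xs = [i, j, k, l]"
    by (auto simp: length_Suc_conv numeral_eq_Suc)
  have "set xs = {1..4}" unfolding xs_def by (simp only: set_sort ys)
  then have e0: "{1..4} = {i, j, k, l}" unfolding xs by simp
  have "distinct xs" unfolding xs_def by (simp only: distinct_sort ys)
  then have e: "enum4 i j k l" using e0 unfolding xs enum4_def by blast
  have "sorted (map (\<lambda>i. - \<bar>n i\<bar>) xs)" unfolding xs_def by (rule sorted_sort_key)
  then have sorted: "\<bar>n j\<bar> \<le> \<bar>n i\<bar>" "\<bar>n k\<bar> \<le> \<bar>n j\<bar>" "\<bar>n l\<bar> \<le> \<bar>n k\<bar>" unfolding xs by simp_all
  define s where "s x = (if n x < 0 then -1 else 1 :: int)" for x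
  have nx: "\<bar>n x\<bar> * (s x * v x) = n x * v x" for x by (simp add: s_def)
  have "\<bar>n i\<bar> * (s i * v i) + \<bar>n j\<bar> * (s j * v j) + \<bar>n k\<bar> * (s k * v k) + \<bar>n l\<bar> * (s l * v l) = 0"
    using assms unfolding doti_def enum4_sum[OF e] nx .
  moreover have "\<forall>x. s x = 1 \<or> s x = -1" by (simp add: s_def)
  ultimately show ?thesis using e sorted by blast
qed

lemma runners_sign:
  assumes "runners v u w t0 z" and s: "\<And>i. s i = 1 \<or> s i = -1"
  shows "runners (\<lambda>i. s i * v i) (\<lambda>i. s i * u i) (\<lambda>i. s i * w i) t0 z"
proof -
  interpret runners v u w t0 z by fact
  have abs: "\<bar>s i * y\<bar> = \<bar>y\<bar>" for i y using s[of i] by auto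
  have s2: "s i * (s i * y) = y" for i y using s[of i] by auto
  show ?thesis
  proof
    show "doti (\<lambda>i. s i * u i) (\<lambda>i. s i * v i) = 1"
      unfolding doti_sign s2 by (rule bez)
    show "\<not> parallel (\<lambda>i. s i * v i) (\<lambda>i. s i * w i)"
    proof
      assume p: "parallel (\<lambda>i. s i * v i) (\<lambda>i. s i * w i)"
      have "v a * w b = v b * w a" if "a \<in> {1..4}" "b \<in> {1..4}" for a b
        using p that s[of a] s[of b] unfolding parallel_def by fastforce
      then show False using np unfolding parallel_def by blast
    qed
    show "\<bar>of_int (s i * w i) - t0 * of_int (s i * v i)\<bar> \<le> (if i = z then 1/5 else 1/6)" if i: "i \<in> {1..4}" for i
      using s[of i] eps[OF i] by (auto simp: abs_minus_commute)
    show "z \<in> {1..4}" by (rule z)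
    show "196 \<le> l1 (\<lambda>i. s i * v i)" using total by (simp add: l1_def abs)
    show "3 \<le> l1 n" if n: "doti n (\<lambda>i. s i * v i) = 0" "\<exists>i\<in>{1..4}. n i \<noteq> 0" for n
    proof -
      have "\<exists>i\<in>{1..4}. s i * n i \<noteq> 0" using n(2) s by (metis mult_eq_0_iff neg_0_equal_iff_equal zero_neq_one)
      then have "3 \<le> l1 (\<lambda>i. s i * n i)" using n(1) no2 unfolding doti_sign by blast
      then show ?thesis by (simp add: l1_def abs)
    qed
  qed
qed

lemma signs_transfer:
  assumes s: "\<And>i. s i = 1 \<or> s i = (-1::int)"
    and P: "\<And>n. doti n v = 0 \<Longrightarrow> \<exists>x\<in>{1..4}. n x \<noteq> 0 \<Longrightarrow> P (\<lambda>x. \<bar>n x\<bar>)"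
    and n: "doti n (\<lambda>i. s i * v i) = 0" "\<exists>x\<in>{1..4}. n x \<noteq> 0"
  shows "P (\<lambda>x. \<bar>n x\<bar>)"
proof -
  have abs: "\<bar>s i * y\<bar> = \<bar>y\<bar>" for i y using s[of i] by auto
  have "\<exists>i\<in>{1..4}. s i * n i \<noteq> 0" using n(2) s by (metis mult_eq_0_iff neg_0_equal_iff_equal zero_neq_one)
  then have "P (\<lambda>x. \<bar>s x * n x\<bar>)" using n(1) P unfolding doti_sign by blast
  then show ?thesis by (simp add: abs)
qed

lemma l1_abs: "l1 (\<lambda>x. \<bar>n x\<bar>) = l1 n"
  by (simp add: l1_def)

text \<open>The cases are ordered so that each type can assume the absence of the shorter or simpler
  ones that its own lemma excludes. The shapes (3,0,0,0), (4,0,0,0) and (2,2,0,0) cannot occur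
  because the speeds are positive and distinct.\<close>

lemma runners_lonely:
  assumes R: "runners v u w t0 z" and vpos: "\<And>i. i \<in> {1..4} \<Longrightarrow> v i > 0"
    and inj: "inj_on v {1..4}"
  shows "lonely v"
proof -
  interpret runners v u w t0 z by fact
  have distinct_sum: "s i * v i + s j * v j \<noteq> 0" if "enum4 i j k l" "\<And>x. s x = 1 \<or> s x = -1" for s i j k l
  proof -
    have ij: "i \<in> {1..4}" "j \<in> {1..4}" "i \<noteq> j" using that(1) enum4_mem[OF that(1)] by (auto simp: enum4_def)
    then have "v i > 0" "v j > 0" "v i \<noteq> v j" using vpos inj_onD[OF inj] by blast+
    then show ?thesis using that(2)[of i] that(2)[of j] by auto
  qed
  have nz: "s i * v i \<noteq> 0" if "enum4 i j k l" "\<And>x. s x = 1 \<or> s x = -1" for s i j k l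
  proof -
    have "v i > 0" using vpos enum4_mem(1)[OF that(1)] by blast
    then show ?thesis using that(2)[of i] by auto
  qed
  define B where "B n \<longleftrightarrow> doti n v = 0 \<and> (\<exists>x\<in>{1..4}. n x \<noteq> 0)" for n
  define unit where "unit n \<longleftrightarrow> (\<forall>x\<in>{1..4}. \<bar>n x\<bar> \<le> (1::int))" for n :: "nat \<Rightarrow> int"
  consider (b) n where "B n" "l1 n = 3" "unit n"
    | (a) n where "B n" "l1 n = 3" "\<And>n. B n \<Longrightarrow> unit n \<Longrightarrow> l1 n \<noteq> 3"
    | (c) n where "B n" "l1 n = 4" "\<not> (\<forall>x\<in>{1..4}. \<bar>n x\<bar> \<le> 2)" "\<And>n. B n \<Longrightarrow> 4 \<le> l1 n"
    | (f) n where "B n" "l1 n = 4" "unit n" "\<And>n. B n \<Longrightarrow> 4 \<le> l1 n"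
    | (e) n where "B n" "l1 n = 4" "\<And>n. B n \<Longrightarrow> 4 \<le> l1 n" "\<And>n. B n \<Longrightarrow> unit n \<Longrightarrow> l1 n \<noteq> 4"
       "\<And>n. B n \<Longrightarrow> l1 n = 4 \<Longrightarrow> \<forall>x\<in>{1..4}. \<bar>n x\<bar> \<le> 2"
    | (w) "\<And>n. B n \<Longrightarrow> 5 \<le> l1 n"
  proof -
    have ge3: "3 \<le> l1 n" if "B n" for n using no2 that by (auto simp: B_def)
    show thesis
    proof (cases "\<exists>n. B n \<and> l1 n = 3")
      case True
      then show thesis using a b by blast
    next
      case False
      then have ge4: "4 \<le> l1 n" if "B n" for n using ge3[OF that] that by force
      show thesis
      proof (cases "\<exists>n. B n \<and> l1 n = 4")
        case True
        then show thesis using c e f ge4 by blast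
      next
        case False
        then have "5 \<le> l1 n" if "B n" for n using ge4[OF that] that by force
        then show thesis by (rule w)
      qed
    qed
  qed
  then show ?thesis
  proof cases
    case w
    show ?thesis
    proof (rule lonely_if_wide[OF np])
      show "\<bar>of_int (w i) - t0 * of_int (v i)\<bar> \<le> 1/5" if "i \<in> {1..4}" for i
        using eps[OF that] by (auto split: if_splits)
      show "5 \<le> l1 n" if "doti n v = 0" "\<exists>i\<in>{1..4}. n i \<noteq> 0" for n
        using w that by (simp add: B_def)
    qed
  next
    case b
    obtain i j k l s where r: "enum4 i j k l" "\<forall>x. s x = 1 \<or> s x = (-1::int)"
      "\<bar>n i\<bar> * (s i * v i) + \<bar>n j\<bar> * (s j * v j) + \<bar>n k\<bar> * (s k * v k) + \<bar>n l\<bar> * (s l * v l) = 0"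
      "\<bar>n j\<bar> \<le> \<bar>n i\<bar>" "\<bar>n k\<bar> \<le> \<bar>n j\<bar>" "\<bar>n l\<bar> \<le> \<bar>n k\<bar>"
      using sorted_relation[of n v] b(1) unfolding B_def by blast
    have s: "\<And>x. s x = 1 \<or> s x = -1" using r(2) by blast
    interpret S: runners "\<lambda>i. s i * v i" "\<lambda>i. s i * u i" "\<lambda>i. s i * w i" t0 z
      by (rule runners_sign[OF R s])
    have "\<bar>n i\<bar> + \<bar>n j\<bar> + \<bar>n k\<bar> + \<bar>n l\<bar> = 3" "\<bar>n i\<bar> \<le> 1"
      using b(2,3) enum4_mem[OF r(1)] unfolding l1_def enum4_sum[OF r(1)] unit_def by auto
    then have n: "\<bar>n i\<bar> = 1" "\<bar>n j\<bar> = 1" "\<bar>n k\<bar> = 1" "\<bar>n l\<bar> = 0" using r(4-6) by linarith+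
    then have rel: "s i * v i + s j * v j + s k * v k = 0" using r(3) by simp
    have en: "enum4 i j k l" "enum4 j i k l" "enum4 k i j l" using r(1) by (auto simp: enum4_def)
    have "lonely (\<lambda>i. s i * v i)"
    proof -
      \<comment> \<open>Of three numbers with sum zero, one is in absolute value the sum of the
        other two; it takes the first place.\<close>
      consider "\<bar>s i * v i\<bar> = \<bar>s j * v j\<bar> + \<bar>s k * v k\<bar>" | "\<bar>s j * v j\<bar> = \<bar>s i * v i\<bar> + \<bar>s k * v k\<bar>"
        | "\<bar>s k * v k\<bar> = \<bar>s i * v i\<bar> + \<bar>s j * v j\<bar>" using rel by linarith
      then show ?thesis
        using S.lonely_sum_zero[OF en(1)] S.lonely_sum_zero[OF en(2)] S.lonely_sum_zero[OF en(3)] rel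
        by cases (simp_all add: add.commute add.left_commute)
    qed
    then show ?thesis by (rule lonely_sign[OF s])
  next
    case a
    obtain i j k l s where r: "enum4 i j k l" "\<forall>x. s x = 1 \<or> s x = (-1::int)"
      "\<bar>n i\<bar> * (s i * v i) + \<bar>n j\<bar> * (s j * v j) + \<bar>n k\<bar> * (s k * v k) + \<bar>n l\<bar> * (s l * v l) = 0"
      "\<bar>n j\<bar> \<le> \<bar>n i\<bar>" "\<bar>n k\<bar> \<le> \<bar>n j\<bar>" "\<bar>n l\<bar> \<le> \<bar>n k\<bar>"
      using sorted_relation[of n v] a(1) unfolding B_def by blast
    have s: "\<And>x. s x = 1 \<or> s x = -1" using r(2) by blast
    interpret S: runners "\<lambda>i. s i * v i" "\<lambda>i. s i * u i" "\<lambda>i. s i * w i" t0 z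
      by (rule runners_sign[OF R s])
    have sum: "\<bar>n i\<bar> + \<bar>n j\<bar> + \<bar>n k\<bar> + \<bar>n l\<bar> = 3"
      using a(2) unfolding l1_def enum4_sum[OF r(1)] .
    have "\<not> \<bar>n i\<bar> \<le> 1"
    proof
      assume "\<bar>n i\<bar> \<le> 1"
      then have "unit n" unfolding unit_def enum4_ball[OF r(1)] using r(4-6) by linarith
      then show False using a by blast
    qed
    moreover have "\<bar>n j\<bar> \<noteq> 0"
    proof
      assume nj: "\<bar>n j\<bar> = 0"
      then have "\<bar>n k\<bar> = 0" "\<bar>n l\<bar> = 0" "\<bar>n i\<bar> = 3" using r(5,6) sum by linarith+
      then show False using r(3) nj nz[where s = s, OF r(1) s] by simp
    qed
    ultimately have n: "\<bar>n i\<bar> = 2" "\<bar>n j\<bar> = 1" "\<bar>n k\<bar> = 0" "\<bar>n l\<bar> = 0" using r(5,6) sum by linarith+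
    then have rel: "s j * v j = - 2 * (s i * v i)" using r(3) by simp
    have "lonely (\<lambda>i. s i * v i)"
    proof (rule S.lonely_ratio_2_3[OF r(1) _ rel])
      fix n' assume n': "doti n' (\<lambda>i. s i * v i) = 0" "\<exists>x\<in>{1..4}. n' x \<noteq> 0" "\<forall>x\<in>{1..4}. \<bar>n' x\<bar> \<le> 1"
      have "unit (\<lambda>x. \<bar>n' x\<bar>) \<longrightarrow> l1 (\<lambda>x. \<bar>n' x\<bar>) \<noteq> 3"
        by (rule signs_transfer[where s = s and v = v and P = "\<lambda>n. unit n \<longrightarrow> l1 n \<noteq> 3", OF s _ n'(1,2)])
          (use a(3) in \<open>auto simp: B_def unit_def l1_abs\<close>)
      then show "l1 n' \<noteq> 3" using n'(3) by (simp add: unit_def l1_abs)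
    qed simp_all
    then show ?thesis by (rule lonely_sign[OF s])
  next
    case c
    obtain i j k l s where r: "enum4 i j k l" "\<forall>x. s x = 1 \<or> s x = (-1::int)"
      "\<bar>n i\<bar> * (s i * v i) + \<bar>n j\<bar> * (s j * v j) + \<bar>n k\<bar> * (s k * v k) + \<bar>n l\<bar> * (s l * v l) = 0"
      "\<bar>n j\<bar> \<le> \<bar>n i\<bar>" "\<bar>n k\<bar> \<le> \<bar>n j\<bar>" "\<bar>n l\<bar> \<le> \<bar>n k\<bar>"
      using sorted_relation[of n v] c(1) unfolding B_def by blast
    have s: "\<And>x. s x = 1 \<or> s x = -1" using r(2) by blast
    interpret S: runners "\<lambda>i. s i * v i" "\<lambda>i. s i * u i" "\<lambda>i. s i * w i" t0 z
      by (rule runners_sign[OF R s])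
    have sum: "\<bar>n i\<bar> + \<bar>n j\<bar> + \<bar>n k\<bar> + \<bar>n l\<bar> = 4"
      using c(2) unfolding l1_def enum4_sum[OF r(1)] .
    have "\<not> \<bar>n i\<bar> \<le> 2" using c(3) r(4-6) unfolding enum4_ball[OF r(1)] by linarith
    moreover have "\<bar>n j\<bar> \<noteq> 0"
    proof
      assume nj: "\<bar>n j\<bar> = 0"
      then have "\<bar>n k\<bar> = 0" "\<bar>n l\<bar> = 0" "\<bar>n i\<bar> = 4" using r(5,6) sum by linarith+
      then show False using r(3) nj nz[where s = s, OF r(1) s] by simp
    qed
    ultimately have n: "\<bar>n i\<bar> = 3" "\<bar>n j\<bar> = 1" "\<bar>n k\<bar> = 0" "\<bar>n l\<bar> = 0" using r(5,6) sum by linarith+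
    then have rel: "s j * v j = - 3 * (s i * v i)" using r(3) by simp
    have ge4: "4 \<le> l1 n'" if "doti n' (\<lambda>i. s i * v i) = 0" "\<exists>x\<in>{1..4}. n' x \<noteq> 0" for n'
      using signs_transfer[where s = s and v = v and P = "\<lambda>n. 4 \<le> l1 n", OF s _ that] c(4)
      by (auto simp: B_def l1_abs)
    have "lonely (\<lambda>i. s i * v i)"
      by (rule S.lonely_ratio_2_3[OF r(1) _ rel]) (use ge4 in force)+
    then show ?thesis by (rule lonely_sign[OF s])
  next
    case f
    obtain i j k l s where r: "enum4 i j k l" "\<forall>x. s x = 1 \<or> s x = (-1::int)"
      "\<bar>n i\<bar> * (s i * v i) + \<bar>n j\<bar> * (s j * v j) + \<bar>n k\<bar> * (s k * v k) + \<bar>n l\<bar> * (s l * v l) = 0"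
      using sorted_relation[of n v] f(1) unfolding B_def by blast
    have s: "\<And>x. s x = 1 \<or> s x = -1" using r(2) by blast
    interpret S: runners "\<lambda>i. s i * v i" "\<lambda>i. s i * u i" "\<lambda>i. s i * w i" t0 z
      by (rule runners_sign[OF R s])
    have "\<bar>n i\<bar> + \<bar>n j\<bar> + \<bar>n k\<bar> + \<bar>n l\<bar> = 4" "\<bar>n i\<bar> \<le> 1" "\<bar>n j\<bar> \<le> 1" "\<bar>n k\<bar> \<le> 1" "\<bar>n l\<bar> \<le> 1"
      using f(2,3) unfolding l1_def enum4_sum[OF r(1)] unit_def enum4_ball[OF r(1)] by auto
    then have n: "\<bar>n i\<bar> = 1" "\<bar>n j\<bar> = 1" "\<bar>n k\<bar> = 1" "\<bar>n l\<bar> = 1" by linarith+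
    then have rel: "s i * v i + s j * v j + s k * v k + s l * v l = 0" using r(3) by simp
    have ge4: "4 \<le> l1 n'" if "doti n' (\<lambda>i. s i * v i) = 0" "\<exists>x\<in>{1..4}. n' x \<noteq> 0" for n'
      using signs_transfer[where s = s and v = v and P = "\<lambda>n. 4 \<le> l1 n", OF s _ that] f(4)
      by (auto simp: B_def l1_abs)
    have "lonely (\<lambda>i. s i * v i)"
      by (rule S.lonely_four_sum_zero[OF r(1) rel ge4])
    then show ?thesis by (rule lonely_sign[OF s])
  next
    case e
    obtain i j k l s where r: "enum4 i j k l" "\<forall>x. s x = 1 \<or> s x = (-1::int)"
      "\<bar>n i\<bar> * (s i * v i) + \<bar>n j\<bar> * (s j * v j) + \<bar>n k\<bar> * (s k * v k) + \<bar>n l\<bar> * (s l * v l) = 0"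
      "\<bar>n j\<bar> \<le> \<bar>n i\<bar>" "\<bar>n k\<bar> \<le> \<bar>n j\<bar>" "\<bar>n l\<bar> \<le> \<bar>n k\<bar>"
      using sorted_relation[of n v] e(1) unfolding B_def by blast
    have s: "\<And>x. s x = 1 \<or> s x = -1" using r(2) by blast
    interpret S: runners "\<lambda>i. s i * v i" "\<lambda>i. s i * u i" "\<lambda>i. s i * w i" t0 z
      by (rule runners_sign[OF R s])
    have sum: "\<bar>n i\<bar> + \<bar>n j\<bar> + \<bar>n k\<bar> + \<bar>n l\<bar> = 4"
      using e(2) unfolding l1_def enum4_sum[OF r(1)] .
    have "\<not> \<bar>n i\<bar> \<le> 1"
    proof
      assume "\<bar>n i\<bar> \<le> 1"
      then have "unit n" unfolding unit_def enum4_ball[OF r(1)] using r(4-6) by linarith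
      then show False using e by blast
    qed
    moreover have "\<bar>n i\<bar> \<le> 2" using e(5)[OF e(1,2)] enum4_mem[OF r(1)] by blast
    moreover have "\<bar>n k\<bar> \<noteq> 0"
    proof
      assume "\<bar>n k\<bar> = 0"
      then have "\<bar>n l\<bar> = 0" "\<bar>n k\<bar> = 0" "\<bar>n i\<bar> = 2" "\<bar>n j\<bar> = 2" using r(4-6) sum \<open>\<bar>n i\<bar> \<le> 2\<close> by linarith+
      then have "2 * (s i * v i + s j * v j) = 0" using r(3) by simp
      then show False using distinct_sum[where s = s, OF r(1) s] by simp
    qed
    ultimately have n: "\<bar>n i\<bar> = 2" "\<bar>n j\<bar> = 1" "\<bar>n k\<bar> = 1" "\<bar>n l\<bar> = 0" using r(5,6) sum by linarith+
    then have rel: "2 * (s i * v i) + s j * v j + s k * v k = 0" using r(3) by simp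
    have T: "4 \<le> l1 (\<lambda>x. \<bar>n' x\<bar>) \<and> (unit (\<lambda>x. \<bar>n' x\<bar>) \<longrightarrow> l1 (\<lambda>x. \<bar>n' x\<bar>) \<noteq> 4) \<and>
        (l1 (\<lambda>x. \<bar>n' x\<bar>) = 4 \<longrightarrow> (\<forall>x\<in>{1..4}. \<bar>\<bar>n' x\<bar>\<bar> \<le> 2))"
      if "doti n' (\<lambda>i. s i * v i) = 0" "\<exists>x\<in>{1..4}. n' x \<noteq> 0" for n'
      by (rule signs_transfer[where s = s and v = v and
            P = "\<lambda>n. 4 \<le> l1 n \<and> (unit n \<longrightarrow> l1 n \<noteq> 4) \<and> (l1 n = 4 \<longrightarrow> (\<forall>x\<in>{1..4}. \<bar>n x\<bar> \<le> 2))", OF s _ that])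
        (use e(3-5) in \<open>auto simp: B_def unit_def l1_abs\<close>)
    have "lonely (\<lambda>i. s i * v i)"
      by (rule S.lonely_double_sum_zero[OF r(1) rel]) (use T in \<open>auto simp: unit_def l1_abs\<close>)
    then show ?thesis by (rule lonely_sign[OF s])
  qed
qed

section \<open>From the hypotheses of the theorem to the locale\<close>

lemma bezout_four:
  fixes v :: "nat \<Rightarrow> nat"
  assumes pos: "\<And>i. i \<in> {1..4} \<Longrightarrow> v i > 0" and g: "Gcd (v ` {1..4}) = 1"
  shows "\<exists>u. doti u (\<lambda>i. int (v i)) = 1"
proof -
  define V where "V i = int (v i)" for i
  have del: "doti (\<lambda>j. if j = i then 1 else 0) V = V i" if "i \<in> {1..4}" for i
    using that by (simp add: doti_def if_distrib[of "\<lambda>x. x * _"] cong: if_cong)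
  have "\<exists>d\<in>range (\<lambda>u. doti u V). d > 0 \<and> (\<forall>x\<in>range (\<lambda>u. doti u V). d dvd x)"
  proof (rule int_subgroup_principal)
    show "V 1 \<in> range (\<lambda>u. doti u V)" using del[of 1] by (metis atLeastAtMost_iff one_le_numeral order_refl rangeI)
    show "V 1 \<noteq> 0" using pos[of 1] by (simp add: V_def)
    fix x y q assume "x \<in> range (\<lambda>u. doti u V)" "y \<in> range (\<lambda>u. doti u V)"
    then obtain zx zy where "x = doti zx V" "y = doti zy V" by auto
    then have "x - q * y = doti (\<lambda>i. 1 * zx i + (- q) * zy i) V" by (simp only: doti_lincomb)
    then show "x - q * y \<in> range (\<lambda>u. doti u V)" by blast
  qed
  then obtain d u where d: "d > 0" "d = doti u V" and dvd: "\<And>x. d dvd doti x V" by auto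
  have "nat d dvd v i" if "i \<in> {1..4}" for i
    using dvd[of "\<lambda>j. if j = i then 1 else 0"] d(1) unfolding del[OF that] V_def
    by (simp add: nat_dvd_iff)
  then have "nat d dvd Gcd (v ` {1..4})" by (intro Gcd_greatest) auto
  then have "d = 1" using d(1) g by simp
  then show ?thesis using d(2) unfolding V_def[abs_def] by auto
qed

theorem corollary1p11:
  fixes v :: "nat \<Rightarrow> nat" and s :: "nat \<Rightarrow> real"
  assumes "\<And>i. i \<in> {1..4} \<Longrightarrow> v i > 0"
    and "inj_on v {1..4}"
    and "Gcd (v ` {1..4}) = 1"
    and "(\<Sum>i=1..4. v i) \<ge> 196"
  shows "\<exists>t::real. \<forall>i\<in>{1..4}. dist_nearest_int (real (v i) * t + s i) \<ge> 1 / 5"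
proof -
  define V where "V i = int (v i)" for i
  have Vpos: "V i > 0" if "i \<in> {1..4}" for i using assms(1)[OF that] by (simp add: V_def)
  have inj: "inj_on V {1..4}" using assms(2) by (simp add: V_def inj_on_def)
  have total: "l1 V \<ge> 196"
  proof -
    have "l1 V = int (\<Sum>i=1..4. v i)" by (simp add: l1_def V_def)
    then show ?thesis using assms(4) by linarith
  qed
  obtain u where bez: "doti u V = 1" using bezout_four[OF assms(1,3)] unfolding V_def by blast
  \<comment> \<open>The runner with only five arcs should be the slowest, as this loses the fewest
    crossings: at most a quarter of the total.\<close>
  obtain z where z: "z \<in> {1..4}" and min: "\<And>i. i \<in> {1..4} \<Longrightarrow> V z \<le> V i"
    using arg_min_if_finite(1)[of "{1..4::nat}" V] arg_min_least[of "{1..4::nat}" _ V] by auto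
  obtain i j k where e: "enum4 z i j k"
  proof -
    define i where "i = (if z = 1 then 2 else 1 :: nat)"
    have "i \<in> {1..4}" "z \<noteq> i" by (auto simp: i_def)
    then show thesis using enum4_ex[OF z] that by blast
  qed
  note mem = enum4_mem[OF e]
  \<comment> \<open>\<open>5 * 6\<^sup>3 < 6 * 196 - 196 / 4\<close>, whereas \<open>6 ^ 4 > 6 * 196\<close>\<close>
  define M where "M i = (if i = z then 5 else 6 :: int)" for i
  have M: "M z = 5" "M i = 6" "M j = 6" "M k = 6" using e by (auto simp: M_def enum4_def)
  have "(\<Prod>i\<in>{1..4}. M i) = 1080"
    using e M unfolding enum4_def by auto
  moreover have "l1 V = V z + V i + V j + V k"
    using Vpos[OF mem(1)] Vpos[OF mem(2)] Vpos[OF mem(3)] Vpos[OF mem(4)] unfolding l1_def enum4_sum[OF e] by simp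
  ultimately have big: "(\<Prod>i\<in>{1..4}. M i) < (\<Sum>i\<in>{1..4}. M i * V i)"
    unfolding enum4_sum[OF e] M using total min[OF mem(2)] min[OF mem(3)] min[OF mem(4)] by simp
  have Mpos: "M x > 0" for x by (simp add: M_def)
  obtain w t0 where w: "\<not> parallel V w" "\<forall>i\<in>{1..4}. \<bar>of_int (w i) - t0 * of_int (V i)\<bar> < 1 / real_of_int (M i)"
    using simultaneous_approximation[OF Vpos Mpos bez big] by blast
  have "runners V u w t0 z"
  proof
    show "doti u V = 1" "\<not> parallel V w" "z \<in> {1..4}" "196 \<le> l1 V" by fact+
    show "\<bar>of_int (w i) - t0 * of_int (V i)\<bar> \<le> (if i = z then 1/5 else 1/6)" if "i \<in> {1..4}" for i
      using less_imp_le[OF bspec[OF w(2) that]] by (simp add: M_def split: if_splits)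
    \<comment> \<open>A nonzero relation of norm at most 2 has one term, or two terms with
      coefficients 1 or -1, contradicting positivity or distinctness.\<close>
    show "3 \<le> l1 n" if n: "doti n V = 0" "\<exists>i\<in>{1..4}. n i \<noteq> 0" for n
    proof (rule ccontr)
      assume lt: "\<not> ?thesis"
      obtain i j k l s where r: "enum4 i j k l" "\<forall>x. s x = 1 \<or> s x = (-1::int)"
        "\<bar>n i\<bar> * (s i * V i) + \<bar>n j\<bar> * (s j * V j) + \<bar>n k\<bar> * (s k * V k) + \<bar>n l\<bar> * (s l * V l) = 0"
        "\<bar>n j\<bar> \<le> \<bar>n i\<bar>" "\<bar>n k\<bar> \<le> \<bar>n j\<bar>" "\<bar>n l\<bar> \<le> \<bar>n k\<bar>"
        using sorted_relation[OF n(1)] by blast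
      have V: "V i > 0" "V j > 0" "V i \<noteq> V j"
      proof -
        have "i \<in> {1..4}" "j \<in> {1..4}" "i \<noteq> j" using r(1) enum4_mem[OF r(1)] by (auto simp: enum4_def)
        then show "V i > 0" "V j > 0" "V i \<noteq> V j" using Vpos inj_onD[OF inj] by blast+
      qed
      have sum: "\<bar>n i\<bar> + \<bar>n j\<bar> + \<bar>n k\<bar> + \<bar>n l\<bar> < 3" using lt unfolding l1_def enum4_sum[OF r(1)] by simp
      have "n i \<noteq> 0 \<or> n j \<noteq> 0 \<or> n k \<noteq> 0 \<or> n l \<noteq> 0" using n(2) r(1) by (auto simp: enum4_def)
      then have "\<bar>n i\<bar> \<ge> 1" using r(4-6) by linarith
      then have kl: "\<bar>n k\<bar> = 0" "\<bar>n l\<bar> = 0" "\<bar>n j\<bar> = 0 \<or> \<bar>n j\<bar> = 1 \<and> \<bar>n i\<bar> = 1" using r(4-6) sum by linarith+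
      have sij: "s i = 1 \<or> s i = -1" "s j = 1 \<or> s j = -1" using r(2) by blast+
      show False
      proof (cases "\<bar>n j\<bar> = 0")
        case True
        then have "\<bar>n i\<bar> * (s i * V i) = 0" using r(3) kl by simp
        then show False using \<open>\<bar>n i\<bar> \<ge> 1\<close> V(1) sij by auto
      next
        case False
        then have "s i * V i + s j * V j = 0" using r(3) kl by simp
        then show False using V sij by auto
      qed
    qed
  qed
  then have "lonely V" using Vpos inj by (rule runners_lonely)
  then show ?thesis unfolding lonely_def V_def by simp
qed

end
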